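(* Input: a matrix $(A,-\mathbf{b})\in\mathbb{Z}^{r\times(n+1)}$ (with $A\in\mathbb{Z}^{r\times n}$, $\mathbf{b}\in\mathbb{Z}^r$) and a strategy $S$. Output: a simplicial cone decomposition of the polyhedron $P(A,\mathbf{b})=\{\alpha\in\mathbb{R}_{\ge 0}^n: A\alpha=\mathbf{b}\}$. That is, the algorithm SimpCone[S] described in the context, run on $(A,-\mathbf{b})$, outputs a finite list $\{(s_1,O_{r,1},J_{r,1}),\dots,(s_N,O_{r,N},J_{r,N})\}$ such that each $K_i^{v_i}:=K^{\cdot}(O_{r,i})$ (with rows $n+1,\dots,n+r$ and the columns in $J_{r,i}$ of $O_{r,i}$ deleted) is a shifted simplicial cone, and $$\sigma_{P(A,\mathbf{b})}(\mathbf{y})=\sum_{i=1}^N s_i\,\sigma_{K_i^{v_i}}(\mathbf{y})$$ as rational functions.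
   Context: For $T\subseteq\mathbb{R}^n$, $\sigma_T(\mathbf{y})=\sum_{\alpha\in T\cap\mathbb{Z}^n}y_1^{\alpha_1}\cdots y_n^{\alpha_n}$. For rational polyhedra containing no straight line this is identified with the rational function it represents. For an $n\times(m+1)$ rational matrix with columns $w_1,\dots,w_m,v$, set $K^{\cdot}(w_1,\dots,w_m,v)=\{v+\sum_i k_iw_i: k_i\in\mathbb{R}_{\ge0}\}$. It is called a shifted simplicial cone if $w_1,\dots,w_m$ are linearly independent. Matrix forms. Let $M=\begin{pmatrix} \mathrm{id}_n & \mathbf{0}\\ A&-\mathbf{b}\end{pmatrix}$, an $(n+r)\times(n+1)$ matrix. For a matrix $O$ of this size, $i\in[r]=\{1,\dots,r\}$ and $j\in[n]$ with the $(n+i,j)$ entry nonzero, $O\leftarrow(i,j)$ is the matrix obtained from $O$ by adding $-O_{n+i,s}/O_{n+i,j}$ times column $j$ to column $s$ for every $s\ne j$. The entry $O_{n+i,j}$ is the pivot item; after the operation row $n+i$ and column $j$ are ignored. A term is a tuple $(s,O,I,J)$ with $s\in\{\pm1\}$, $I\subseteq[r]$ the set of indices $i$ whose rows $n+i$ are ignored, and $J\subseteq[n]$ the set of ignored columns. Contributing columns. Fix a term $(s,O,I,J)$ and $i\in[r]\setminus I$. For $j\in[n]\setminus J$ let $\gamma_j$ be the $j$th column of $O$ with the rows $n+I$ ignored, and let $p_j$ be its entry in row $n+i$. A column vector is small if its first nonzero entry is positive and large otherwise. Column $j$ is contributing (with respect to the variable $\lambda_i$ attached to row $n+i$) if $p_j\neq0$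 and $p_j\gamma_j$ is small, and dually contributing if $p_j\ne0$ and $p_j\gamma_j$ is large. Let $b_0=O_{n+i,n+1}$, $\deg=b_0-\sum_{j\notin J,\,p_j>0}p_j$ and $\mathrm{ord}=-b_0+\sum_{j\notin J,\,p_j<0}p_j$. The contributing formula is applicable for $i$ if $\deg<0$; the dual formula is applicable for $i$ if $\mathrm{ord}<0$. Algorithm SimpCone[S]. Start with the collection $O_0=\{(1,M,\varnothing,\varnothing)\}$. For $t=0,1,\dots,r-1$, build the collection $O_{t+1}$ from $O_t$ as follows. For each term $(s,O,I,J)$ of $O_t$, choose, according to the strategy $S$, an index $i\in[r]\setminus I$ and one formula applicable for $i$ (contributing or dual). If the contributing formula is chosen, add to $O_{t+1}$ the terms $(s\cdot\mathrm{sgn}(p_j),\,O\leftarrow(i,j),\,I\cup\{i\},\,J\cup\{j\})$ for all contributing $j$. If the dual formula is chosen, add the terms $(-s\cdot\mathrm{sgn}(p_j),\,O\leftarrow(i,j),\,I\cup\{i\},\,J\cup\{j\})$ for all dually contributing $j$. Output $O_r$ (in which $I=[r]$ for every term, so $I$ is dropped). A strategy is a rule for making these choices. *)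

theory Defs
  imports
    "HOL-Library.Poly_Mapping"
    "HOL-Computational_Algebra.Fraction_Field"
    "Jordan_Normal_Form.VS_Connect"
    "Jordan_Normal_Form.DL_Submatrix"
begin

text \<open>
  Indices of variables, rows, columns are 0-based throughout.  Points of n-dimensional real space
  are the elements of \<^term>\<open>carrier_vec n :: real vec set\<close>.
\<close>

section \<open>Lattice point generating functions as rational functions\<close>

text \<open>
  An exponent is a finitely supported family of integers, so a Laurent polynomial is a finitely
  supported family of coefficients indexed by exponents. Rational functions in the variables
  \<open>y\<^sub>0, y\<^sub>1, \<dots>\<close> form the fraction field of the Laurent polynomials.
\<close>

type_synonym exponent = "nat \<Rightarrow>\<^sub>0 int"
type_synonym laurent = "exponent \<Rightarrow>\<^sub>0 rat"
type_synonym ratfun = "laurent fract"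

text \<open>
  Formal two-sided series are arbitrary functions on exponents. They have no product, but are a
  module over the Laurent polynomials.
\<close>

type_synonym series = "exponent \<Rightarrow> rat"

definition laurent_times :: "laurent \<Rightarrow> series \<Rightarrow> series" where
  "laurent_times q f = (\<lambda>e. \<Sum>d\<in>Poly_Mapping.keys q. Poly_Mapping.lookup q d * f (e - d))"

definition represents :: "ratfun \<Rightarrow> series \<Rightarrow> bool" where
  "represents F f \<longleftrightarrow> (\<exists>p q. q \<noteq> 0 \<and> laurent_times q f = Poly_Mapping.lookup p \<and> F = Fract p q)"

definition lattice_series :: "nat \<Rightarrow> real vec set \<Rightarrow> series" where
  "lattice_series n T =
     (\<lambda>e. if Poly_Mapping.keys e \<subseteq> {..<n} \<and> vec n (\<lambda>i. real_of_int (Poly_Mapping.lookup e i)) \<in> T then 1 else 0)"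

definition has_rational_gf :: "nat \<Rightarrow> real vec set \<Rightarrow> bool" where
  "has_rational_gf n T \<longleftrightarrow> (\<exists>F. represents F (lattice_series n T))"

definition sigma :: "nat \<Rightarrow> real vec set \<Rightarrow> ratfun" where
  "sigma n T = (THE F. represents F (lattice_series n T))"

lemma laurent_times_lookup: "laurent_times p (Poly_Mapping.lookup q) = Poly_Mapping.lookup (p * q)"
proof
  fix e
  have "Poly_Mapping.lookup (p * q) e = (\<Sum>d. Poly_Mapping.lookup p d * (\<Sum>c. Poly_Mapping.lookup q c when e = d + c))"
    by (simp add: times_poly_mapping.rep_eq prod_fun_def)
  also have "\<dots> = (\<Sum>d. Poly_Mapping.lookup p d * Poly_Mapping.lookup q (e - d))"
  proof (rule Sum_any.cong)
    fix d
    have "(\<lambda>c. Poly_Mapping.lookup q c when e = d + c) = (\<lambda>c. Poly_Mapping.lookup q c when c = e - d)"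
      by (auto simp: fun_eq_iff when_def algebra_simps)
    then show "Poly_Mapping.lookup p d * (\<Sum>c. Poly_Mapping.lookup q c when e = d + c) = Poly_Mapping.lookup p d * Poly_Mapping.lookup q (e - d)"
      by (simp only: Sum_any_when_equal)
  qed
  also have "\<dots> = laurent_times p (Poly_Mapping.lookup q) e"
    unfolding laurent_times_def
    by (rule Sum_any.expand_superset) (auto simp: in_keys_iff)
  finally show "laurent_times p (Poly_Mapping.lookup q) e = Poly_Mapping.lookup (p * q) e" ..
qed

lemma laurent_times_commute:
  "laurent_times p (laurent_times q f) = laurent_times q (laurent_times p f)"
  unfolding laurent_times_def fun_eq_iff
  by (subst sum_distrib_left, subst sum_distrib_left, subst sum.swap)
     (auto intro!: sum.cong simp: algebra_simps)

lemma represents_unique: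
  assumes "represents F f" "represents G f"
  shows "F = G"
proof -
  obtain p q where pq: "q \<noteq> 0" "laurent_times q f = Poly_Mapping.lookup p" "F = Fract p q"
    using assms(1) by (auto simp: represents_def)
  obtain p' q' where pq': "q' \<noteq> 0" "laurent_times q' f = Poly_Mapping.lookup p'" "G = Fract p' q'"
    using assms(2) by (auto simp: represents_def)
  have "Poly_Mapping.lookup (q' * p) = Poly_Mapping.lookup (q * p')"
    using laurent_times_commute[of q' q f] pq(2) pq'(2) by (simp add: laurent_times_lookup)
  then have "q' * p = q * p'" by (simp add: poly_mapping.lookup_inject)
  then show ?thesis using pq pq' by (simp add: eq_fract mult.commute)
qed

lemma sigma_eqI: "represents F (lattice_series n T) \<Longrightarrow> sigma n T = F"
  unfolding sigma_def using represents_unique by blast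

section \<open>Polyhedra and shifted cones\<close>

definition polyhedron :: "int mat \<Rightarrow> int vec \<Rightarrow> real vec set" where
  "polyhedron A b =
     {x \<in> carrier_vec (dim_col A). (\<forall>i<dim_col A. 0 \<le> x $ i) \<and>
        map_mat real_of_int A *\<^sub>v x = map_vec real_of_int b}"

text \<open>The last column of the matrix is the vertex, the other columns are the generators.\<close>

definition shifted_cone :: "rat mat \<Rightarrow> real vec set" where
  "shifted_cone W = (let m = dim_col W - 1 in
     {vec (dim_row W) (\<lambda>i. of_rat (W $$ (i, m)) + (\<Sum>l<m. k l * of_rat (W $$ (i, l))))
       | k. \<forall>l<m. (0::real) \<le> k l})"

definition generators :: "rat mat \<Rightarrow> real vec list" where
  "generators W = map (\<lambda>l. map_vec of_rat (col W l)) [0..<dim_col W - 1]"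

definition simplicial :: "rat mat \<Rightarrow> bool" where
  "simplicial W \<longleftrightarrow> 0 < dim_col W \<and> distinct (generators W) \<and>
     module.lin_indpt class_ring (module_vec TYPE(real) (dim_row W)) (set (generators W))"

section \<open>The algorithm\<close>

type_synonym cone_term = "int \<times> rat mat \<times> nat set \<times> nat set"

datatype formula = Contributing | Dual

definition initial_matrix :: "int mat \<Rightarrow> int vec \<Rightarrow> rat mat" where
  "initial_matrix A b = (let n = dim_col A; r = dim_row A in
     four_block_mat (1\<^sub>m n) (0\<^sub>m n 1)
       (map_mat of_int A) (mat_of_cols r [- map_vec of_int b]))"

text \<open>In the following, \<open>n\<close> is the number of columns of \<open>A\<close>; the last column of \<open>X\<close> has index \<open>n\<close>.\<close>

definition pivot :: "nat \<Rightarrow> rat mat \<Rightarrow> nat \<Rightarrow> nat \<Rightarrow> rat mat" where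
  "pivot n X i j = mat (dim_row X) (dim_col X) (\<lambda>(k, s).
     if s = j then X $$ (k, j)
     else X $$ (k, s) + (- X $$ (n + i, s) / X $$ (n + i, j)) * X $$ (k, j))"

definition small :: "rat list \<Rightarrow> bool" where
  "small xs \<longleftrightarrow> (\<exists>k<length xs. 0 < xs ! k \<and> (\<forall>l<k. xs ! l = 0))"

definition active_column :: "nat \<Rightarrow> rat mat \<Rightarrow> nat set \<Rightarrow> nat \<Rightarrow> rat list" where
  "active_column n X I j =
     map (\<lambda>k. X $$ (k, j)) (filter (\<lambda>k. k \<notin> (\<lambda>i. n + i) ` I) [0..<dim_row X])"

definition contributing :: "nat \<Rightarrow> rat mat \<Rightarrow> nat set \<Rightarrow> nat \<Rightarrow> nat \<Rightarrow> bool" where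
  "contributing n X I i j \<longleftrightarrow> X $$ (n + i, j) \<noteq> 0 \<and>
     small (map ((*) (X $$ (n + i, j))) (active_column n X I j))"

definition dually_contributing :: "nat \<Rightarrow> rat mat \<Rightarrow> nat set \<Rightarrow> nat \<Rightarrow> nat \<Rightarrow> bool" where
  "dually_contributing n X I i j \<longleftrightarrow> X $$ (n + i, j) \<noteq> 0 \<and>
     \<not> small (map ((*) (X $$ (n + i, j))) (active_column n X I j))"

definition lambda_deg :: "nat \<Rightarrow> rat mat \<Rightarrow> nat set \<Rightarrow> nat \<Rightarrow> rat" where
  "lambda_deg n X J i =
     X $$ (n + i, n) - (\<Sum>j\<in>{j \<in> {..<n} - J. 0 < X $$ (n + i, j)}. X $$ (n + i, j))"

definition lambda_ord :: "nat \<Rightarrow> rat mat \<Rightarrow> nat set \<Rightarrow> nat \<Rightarrow> rat" where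
  "lambda_ord n X J i =
     - X $$ (n + i, n) + (\<Sum>j\<in>{j \<in> {..<n} - J. X $$ (n + i, j) < 0}. X $$ (n + i, j))"

fun applicable :: "nat \<Rightarrow> rat mat \<Rightarrow> nat set \<Rightarrow> nat \<Rightarrow> formula \<Rightarrow> bool" where
  "applicable n X J i Contributing \<longleftrightarrow> lambda_deg n X J i < 0"
| "applicable n X J i Dual \<longleftrightarrow> lambda_ord n X J i < 0"

definition sign :: "rat \<Rightarrow> int" where
  "sign x = (if x > 0 then 1 else if x < 0 then - 1 else 0)"

fun eliminate :: "nat \<Rightarrow> cone_term \<Rightarrow> nat \<times> formula \<Rightarrow> cone_term list" where
  "eliminate n (s, X, I, J) (i, Contributing) =
     [(s * sign (X $$ (n + i, j)), pivot n X i j, insert i I, insert j J).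
        j \<leftarrow> [0..<n], j \<notin> J \<and> contributing n X I i j]"
| "eliminate n (s, X, I, J) (i, Dual) =
     [(- s * sign (X $$ (n + i, j)), pivot n X i j, insert i I, insert j J).
        j \<leftarrow> [0..<n], j \<notin> J \<and> dually_contributing n X I i j]"

text \<open>
  Collections are lists, since the same term may occur several times. A strategy sees the whole
  current collection and the position of the term to be processed, so that equal terms of a
  collection may be treated differently.
\<close>

type_synonym strategy = "cone_term list \<Rightarrow> nat \<Rightarrow> nat \<times> formula"

fun collection :: "strategy \<Rightarrow> int mat \<Rightarrow> int vec \<Rightarrow> nat \<Rightarrow> cone_term list" where
  "collection S A b 0 = [(1, initial_matrix A b, {}, {})]"
| "collection S A b (Suc t) = (let L = collection S A b t in
     concat (map (\<lambda>k. eliminate (dim_col A) (L ! k) (S L k)) [0..<length L]))"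

fun legal_choice :: "nat \<Rightarrow> nat \<Rightarrow> cone_term \<Rightarrow> nat \<times> formula \<Rightarrow> bool" where
  "legal_choice n r (s, X, I, J) (i, \<phi>) \<longleftrightarrow> i < r \<and> i \<notin> I \<and> applicable n X J i \<phi>"

definition strategy_for :: "strategy \<Rightarrow> int mat \<Rightarrow> int vec \<Rightarrow> bool" where
  "strategy_for S A b \<longleftrightarrow> (\<forall>t<dim_row A. let L = collection S A b t in
     \<forall>k<length L. legal_choice (dim_col A) (dim_row A) (L ! k) (S L k))"

definition SimpCone :: "strategy \<Rightarrow> int mat \<Rightarrow> int vec \<Rightarrow> (int \<times> rat mat \<times> nat set) list" where
  "SimpCone S A b = map (\<lambda>(s, X, I, J). (s, X, J)) (collection S A b (dim_row A))"

definition output_matrix :: "nat \<Rightarrow> rat mat \<Rightarrow> nat set \<Rightarrow> rat mat" where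
  "output_matrix n X J = submatrix X {..<n} (- J)"

text \<open>
  A legal choice is missing only if all remaining rows vanish outside the ignored columns, which
  happens only for linearly dependent rows of \<open>(A, -b)\<close>.
\<close>

lemma applicable_exists:
  assumes "j < n" "j \<notin> J" "X $$ (n + i, j) \<noteq> 0"
  shows "\<exists>\<phi>. applicable n X J i \<phi>"
proof -
  let ?p = "\<lambda>j. X $$ (n + i, j)"
  let ?P = "{j \<in> {..<n} - J. 0 < ?p j}" and ?N = "{j \<in> {..<n} - J. ?p j < 0}"
  have nonneg: "0 \<le> sum ?p ?P" "sum ?p ?N \<le> 0"
    by (auto intro: sum_nonneg sum_nonpos)
  have "0 < sum ?p ?P \<or> sum ?p ?N < 0"
  proof (cases "?p j > 0")
    case True
    have "?p j \<le> sum ?p ?P" by (rule member_le_sum) (use assms True in auto)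
    then show ?thesis using True by auto
  next
    case False
    have "- ?p j \<le> (\<Sum>j\<in>?N. - ?p j)" by (rule member_le_sum) (use assms False in auto)
    then show ?thesis using False assms(3) by (auto simp: sum_negf)
  qed
  then have "lambda_deg n X J i + lambda_ord n X J i < 0"
    using nonneg unfolding lambda_deg_def lambda_ord_def by linarith
  then have "lambda_deg n X J i < 0 \<or> lambda_ord n X J i < 0" by linarith
  then show ?thesis by (metis applicable.simps)
qed

lemma applicable_exists':
  assumes "X $$ (n + i, n) \<noteq> 0"
  shows "\<exists>\<phi>. applicable n X J i \<phi>"
proof (cases "\<exists>j<n. j \<notin> J \<and> X $$ (n + i, j) \<noteq> 0")
  case True
  then show ?thesis using applicable_exists by blast
next
  case False
  then have "{j \<in> {..<n} - J. 0 < X $$ (n + i, j)} = {}" "{j \<in> {..<n} - J. X $$ (n + i, j) < 0} = {}"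
    by fastforce+
  then have "lambda_deg n X J i = X $$ (n + i, n)" "lambda_ord n X J i = - X $$ (n + i, n)"
    by (simp_all only: lambda_deg_def lambda_ord_def sum.empty diff_zero add_0_right)
  then have "lambda_deg n X J i < 0 \<or> lambda_ord n X J i < 0" using assms by linarith
  then show ?thesis by (metis applicable.simps)
qed

end

theory Submission
  imports Defs
begin

text \<open>
  The row of a column \<open>s \<notin> J\<close> in a term is always the unit vector \<open>e\<^sub>s\<close>, so on the affine hull of its
  cone the cone coordinates are original coordinates \<open>y\<^sub>s\<close>, hence integers at lattice points.  Give a
  term the function \<open>\<Prod>\<^sub>s \<chi>\<^sub>s(y\<^sub>s)\<close> on the lattice points of this hull that satisfy the remaining
  equations, where \<open>\<chi>\<^sub>s\<close> is \<open>[y\<^sub>s \<ge> 0]\<close> if column \<open>s\<close> is lexicographically positive and \<open>- [y\<^sub>s < 0]\<close>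
  otherwise.

  An elimination step preserves the signed sum of these functions pointwise.  Order the columns
  with nonzero pivot item by \<open>w\<^sub>s / p\<^sub>s\<close> lexicographically; the contributing columns form an upper
  set, and the sum over them telescopes to the old function up to a boundary term, the function of
  the points with \<open>y\<^sub>s < 0\<close> for \<open>p\<^sub>s > 0\<close> and \<open>y\<^sub>s \<ge> 0\<close> for \<open>p\<^sub>s < 0\<close>.  As the \<open>y\<^sub>s\<close> are integers,
  \<open>deg < 0\<close> excludes such points.  The dual formula leaves the opposite boundary term.

  Finally, \<open>[y \<ge> 0]\<close> and \<open>- [y < 0]\<close> differ by a constant, hence have equal differences, so the
  function of an output term represents the same rational function as the lattice series of its cone.
\<close>

section \<open>Formal series and the Laurent module\<close>

lemma laurent_times_superset:
  assumes "finite K" "Poly_Mapping.keys q \<subseteq> K"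
  shows "laurent_times q f e = (\<Sum>d\<in>K. Poly_Mapping.lookup q d * f (e - d))"
  unfolding laurent_times_def
  by (rule sum.mono_neutral_left) (use assms in \<open>auto simp: in_keys_iff\<close>)

text \<open>This lets a product of denominators act on a series one factor at a time.\<close>

lemma laurent_times_mult: "laurent_times (p * q) f = laurent_times p (laurent_times q f)"
proof
  fix e
  let ?P = "Poly_Mapping.keys p" and ?Q = "Poly_Mapping.keys q"
  \<comment> \<open>Cancellation can make the support of \<open>p * q\<close> smaller than this
    sumset; a fixed index set allows the two sums to be swapped.\<close>
  define K where "K = (\<lambda>(c, d). c + d) ` (?P \<times> ?Q)"
  have K: "finite K" unfolding K_def by simp
  have sub: "Poly_Mapping.keys (p * q) \<subseteq> K"
    using keys_mult[of p q] unfolding K_def by auto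
  have inner: "(\<Sum>c\<in>K. Poly_Mapping.lookup q (c - d) * f (e - c))
      = laurent_times q f (e - d)" if "d \<in> ?P" for d
  proof -
    have "(\<Sum>c\<in>K. Poly_Mapping.lookup q (c - d) * f (e - c))
        = (\<Sum>c\<in>(+) d ` ?Q. Poly_Mapping.lookup q (c - d) * f (e - c))"
    proof (rule sum.mono_neutral_right[OF K])
      show "(+) d ` ?Q \<subseteq> K" using that unfolding K_def by auto
      show "\<forall>c\<in>K - (+) d ` ?Q. Poly_Mapping.lookup q (c - d) * f (e - c) = 0"
      proof
        fix c assume "c \<in> K - (+) d ` ?Q"
        then have "c - d \<notin> ?Q" by (metis DiffD2 add.commute diff_add_cancel image_eqI)
        then show "Poly_Mapping.lookup q (c - d) * f (e - c) = 0" by (simp add: in_keys_iff)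
      qed
    qed
    also have "\<dots> = (\<Sum>c\<in>?Q. Poly_Mapping.lookup q c * f (e - d - c))"
      by (subst sum.reindex) (auto simp: inj_on_def diff_diff_eq)
    finally show ?thesis by (simp add: laurent_times_def)
  qed
  have "laurent_times (p * q) f e
      = (\<Sum>c\<in>K. (\<Sum>d\<in>?P. Poly_Mapping.lookup p d * Poly_Mapping.lookup q (c - d)) * f (e - c))"
    unfolding laurent_times_superset[OF K sub] laurent_times_lookup[symmetric]
    by (simp add: laurent_times_def)
  also have "\<dots> = (\<Sum>d\<in>?P. \<Sum>c\<in>K. Poly_Mapping.lookup p d * Poly_Mapping.lookup q (c - d) * f (e - c))"
    by (subst sum.swap) (simp add: sum_distrib_right)
  also have "\<dots> = (\<Sum>d\<in>?P. Poly_Mapping.lookup p d * (\<Sum>c\<in>K. Poly_Mapping.lookup q (c - d) * f (e - c)))"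
    by (simp add: sum_distrib_left mult.assoc)
  also have "\<dots> = (\<Sum>d\<in>?P. Poly_Mapping.lookup p d * laurent_times q f (e - d))"
    by (intro sum.cong refl) (simp only: inner)
  finally show "laurent_times (p * q) f e = laurent_times p (laurent_times q f) e"
    by (simp add: laurent_times_def)
qed

lemma laurent_times_one: "laurent_times 1 f = f"
  by (simp add: laurent_times_def lookup_one fun_eq_iff)

text \<open>The backward difference along \<open>w\<close>: this is the operator that cuts the
  geometric series of one generator down to finitely many terms.\<close>

lemma laurent_times_one_minus_monomial:
  "laurent_times (1 - Poly_Mapping.single w 1) f = (\<lambda>e. f e - f (e - w))"
proof
  fix e
  have "Poly_Mapping.keys (1 - Poly_Mapping.single w 1 :: laurent) \<subseteq> {0, w}"
    by (auto simp: in_keys_iff lookup_minus lookup_one lookup_single when_def split: if_splits)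
  from laurent_times_superset[OF _ this, of f e]
  show "laurent_times (1 - Poly_Mapping.single w 1) f e = f e - f (e - w)"
    by (cases "w = 0") (auto simp: lookup_minus lookup_one lookup_single)
qed

lemma one_minus_monomial_nonzero:
  assumes "w \<noteq> 0"
  shows "1 - Poly_Mapping.single w 1 \<noteq> (0 :: laurent)"
proof
  assume "1 - Poly_Mapping.single w 1 = (0 :: laurent)"
  then have "Poly_Mapping.lookup (1 - Poly_Mapping.single w 1 :: laurent) 0 = 0" by simp
  then show False using assms by (simp add: lookup_minus lookup_one lookup_single)
qed

section \<open>Linearity of the passage from series to rational functions\<close>

lemma represents_zero: "represents 0 (\<lambda>_. 0)"
  unfolding represents_def
  by (rule exI[of _ 0], rule exI[of _ 1])
     (simp add: laurent_times_one fun_eq_iff fract_collapse)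

text \<open>The product of the two denominators clears both series.\<close>

lemma represents_add:
  assumes "represents F f" "represents G g"
  shows "represents (F + G) (\<lambda>e. f e + g e)"
proof -
  obtain p q where pq: "q \<noteq> 0" "laurent_times q f = Poly_Mapping.lookup p" "F = Fract p q"
    using assms(1) by (auto simp: represents_def)
  obtain p' q' where pq': "q' \<noteq> 0" "laurent_times q' g = Poly_Mapping.lookup p'" "G = Fract p' q'"
    using assms(2) by (auto simp: represents_def)
  have "laurent_times (q * q') (\<lambda>e. f e + g e)
      = (\<lambda>e. laurent_times (q' * q) f e + laurent_times (q * q') g e)"
    by (simp add: laurent_times_def algebra_simps sum.distrib)
  also have "\<dots> = Poly_Mapping.lookup (p * q' + p' * q)"
    using laurent_times_commute[of q' q g]
    by (simp add: laurent_times_mult pq pq' laurent_times_lookup fun_eq_iff lookup_add mult.commute)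
  finally show ?thesis
    unfolding represents_def using pq pq'
    by (intro exI[of _ "p * q' + p' * q"] exI[of _ "q * q'"]) simp
qed

lemma represents_of_int_times:
  assumes "represents F f"
  shows "represents (of_int s * F) (\<lambda>e. of_int s * f e)"
proof -
  obtain p q where pq: "q \<noteq> 0" "laurent_times q f = Poly_Mapping.lookup p" "F = Fract p q"
    using assms by (auto simp: represents_def)
  have "of_int s = Fract (of_int s :: laurent) 1"
    by (cases s) (simp_all add: Fract_of_nat_eq minus_fract[symmetric] del: minus_fract of_nat_Suc)
  then have "of_int s * F = Fract (of_int s * p) q"
    using pq by simp
  moreover have "laurent_times q (\<lambda>e. of_int s * f e) = Poly_Mapping.lookup (of_int s * p)"
  proof
    fix e
    have "Poly_Mapping.keys (of_int s :: laurent) \<subseteq> {0}"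
      by (auto simp: in_keys_iff lookup_of_int when_def split: if_splits)
    from laurent_times_superset[OF _ this, of "Poly_Mapping.lookup p" e]
    have "Poly_Mapping.lookup (of_int s * p) e = of_int s * Poly_Mapping.lookup p e"
      by (simp add: laurent_times_lookup lookup_of_int)
    then show "laurent_times q (\<lambda>e. of_int s * f e) e = Poly_Mapping.lookup (of_int s * p) e"
      unfolding pq(2)[symmetric] by (simp add: laurent_times_def sum_distrib_left algebra_simps)
  qed
  ultimately show ?thesis using pq(1) unfolding represents_def by blast
qed

lemma represents_sum_list:
  assumes "\<And>x. x \<in> set xs \<Longrightarrow> represents (F x) (f x)"
  shows "represents (\<Sum>x\<leftarrow>xs. F x) (\<lambda>e. \<Sum>x\<leftarrow>xs. f x e)"
  using assms by (induction xs) (auto intro: represents_zero represents_add)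

section \<open>Lexicographic signs\<close>

text \<open>The condition \<open>small\<close>, restated for functions read only below
  \<open>n\<close>, so that columns can be scaled and subtracted pointwise.\<close>

definition lexpos :: "nat \<Rightarrow> (nat \<Rightarrow> rat) \<Rightarrow> bool" where
  "lexpos n f \<longleftrightarrow> (\<exists>k<n. 0 < f k \<and> (\<forall>l<k. f l = 0))"

text \<open>The leading entry of the sum sits at the smaller of the two leading indices, where
  nothing can cancel.\<close>

lemma lexpos_add:
  assumes "lexpos n f" "lexpos n g"
  shows "lexpos n (\<lambda>k. f k + g k)"
proof -
  obtain k l where k: "k < n" "0 < f k" "\<forall>i<k. f i = 0" and l: "l < n" "0 < g l" "\<forall>i<l. g i = 0"
    using assms unfolding lexpos_def by blast
  then show ?thesis
    unfolding lexpos_def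
    by (intro exI[of _ "min k l"], cases k l rule: linorder_cases) (auto simp: min_def)
qed

lemma lexpos_scale: "0 < c \<Longrightarrow> lexpos n (\<lambda>k. c * f k) \<longleftrightarrow> lexpos n f"
  unfolding lexpos_def by (auto simp: zero_less_mult_iff)

lemma not_lexpos_uminus:
  assumes "lexpos n f"
  shows "\<not> lexpos n (\<lambda>k. - f k)"
proof
  assume "lexpos n (\<lambda>k. - f k)"
  then obtain k l where "0 < f k" "\<forall>i<k. f i = 0" "f l < 0" "\<forall>i<l. f i = 0"
    using assms unfolding lexpos_def by auto
  then show False by (cases k l rule: linorder_cases) auto
qed

text \<open>The least index of a nonzero entry decides the sign. Together with
  \<open>not_lexpos_uminus\<close>, a nonzero vector has exactly one of the two signs.\<close>

lemma lexpos_cases: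
  assumes "i < n" "f i \<noteq> 0"
  shows "lexpos n f \<or> lexpos n (\<lambda>k. - f k)"
proof -
  define k where "k = (LEAST k. f k \<noteq> 0)"
  have "f k \<noteq> 0" "k \<le> i"
    unfolding k_def using assms(2) by (fact LeastI, simp add: Least_le)
  moreover have "\<forall>l<k. f l = 0" unfolding k_def using not_less_Least by blast
  ultimately have "k < n" "0 < f k \<or> 0 < - f k" "\<forall>l<k. f l = 0" "\<forall>l<k. - f l = 0"
    using assms by auto
  then show ?thesis unfolding lexpos_def by blast
qed

lemma lexpos_cong:
  assumes "\<And>k. k < n \<Longrightarrow> f k = g k"
  shows "lexpos n f \<longleftrightarrow> lexpos n g"
proof -
  have "(0 < f k \<and> (\<forall>l<k. f l = 0)) \<longleftrightarrow> (0 < g k \<and> (\<forall>l<k. g l = 0))" if "k < n" for k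
    using assms that by auto
  then show ?thesis unfolding lexpos_def by blast
qed

text \<open>A nonzero entry among the first \<open>n\<close> puts the leading entry there too, so
  the constraint rows \<open>xs\<close> never decide the sign of a column.\<close>

lemma small_append_iff_lexpos:
  assumes "i < n" "f i \<noteq> 0"
  shows "small (map f [0..<n] @ xs) \<longleftrightarrow> lexpos n f"
proof -
  define g where "g k = (map f [0..<n] @ xs) ! k" for k
  have g: "g k = f k" if "k < n" for k
    using that by (simp add: g_def nth_append)
  have bound: "k < n" if "\<forall>l<k. g l = 0" "0 < g k" for k
  proof (rule ccontr)
    assume "\<not> k < n"
    then have "g i = 0" using that assms by simp
    then show False using assms by (simp add: g)
  qed
  have "(\<exists>k<n + length xs. 0 < g k \<and> (\<forall>l<k. g l = 0)) \<longleftrightarrow> (\<exists>k<n. 0 < g k \<and> (\<forall>l<k. g l = 0))"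
    using bound by (meson trans_less_add1)
  also have "\<dots> \<longleftrightarrow> lexpos n f"
    using lexpos_cong[of n g f] g unfolding lexpos_def by simp
  finally show ?thesis unfolding small_def g_def by simp
qed

section \<open>A telescoping identity\<close>

text \<open>Since \<open>P j - m j = 1\<close>, the summand of \<open>j\<close> is the change of a
  product when its factor at \<open>j\<close> switches from \<open>m\<close> to \<open>P\<close>.
  Going down along \<open>R\<close> from its largest element, these switches lead from
  \<open>prod m S\<close> to \<open>prod P S\<close>.\<close>

lemma telescoping_products:
  fixes P m :: "'a \<Rightarrow> 'b::comm_ring_1"
  assumes "finite S" and "asymp_on S R" and "transp_on S R" and "totalp_on S R"
    and "\<And>s. s \<in> S \<Longrightarrow> P s = m s + 1"
  shows "(\<Sum>j\<in>S. (\<Prod>s\<in>S - {j}. if R j s then P s else m s)) = prod P S - prod m S"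
  using assms
proof (induction "card S" arbitrary: S)
  case 0
  then show ?case by simp
next
  case (Suc k)
  have "S \<noteq> {}" using Suc.hyps(2) by auto
  then obtain a where a: "a \<in> S" "\<forall>x\<in>S. x \<noteq> a \<longrightarrow> \<not> R a x"
    using Finite_Set.bex_max_element[OF Suc.prems(1-3)] by blast
  \<comment> \<open>The largest element \<open>a\<close> contributes the factor \<open>P a\<close>
    to every other summand, and its own summand is \<open>prod m T\<close>.\<close>
  define T where "T = S - {a}"
  have S: "S = insert a T" "a \<notin> T" "finite T" using a(1) Suc.prems(1) unfolding T_def by auto
  have max: "R s a" "\<not> R a s" if "s \<in> T" for s
    using a that Suc.prems(4) unfolding T_def totalp_on_def by blast+
  have IH: "(\<Sum>j\<in>T. (\<Prod>s\<in>T - {j}. if R j s then P s else m s)) = prod P T - prod m T"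
  proof (rule Suc.hyps(1))
    show "k = card T" using Suc.hyps(2) S by simp
    show "asymp_on T R" "transp_on T R" "totalp_on T R"
      using Suc.prems(2-4) S(1) by (auto intro: asymp_on_subset transp_on_subset totalp_on_subset)
  qed (use S Suc.prems in auto)
  have "(\<Prod>s\<in>S - {j}. if R j s then P s else m s)
      = P a * (\<Prod>s\<in>T - {j}. if R j s then P s else m s)" if "j \<in> T" for j
  proof -
    have "S - {j} = insert a (T - {j})" using S that by auto
    then show ?thesis using S max[OF that] by simp
  qed
  moreover have "(\<Prod>s\<in>S - {a}. if R a s then P s else m s) = prod m T"
    using max S by (intro prod.cong) auto
  ultimately have "(\<Sum>j\<in>S. (\<Prod>s\<in>S - {j}. if R j s then P s else m s))
      = prod m T + P a * (prod P T - prod m T)"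
    using S IH by (simp add: sum_distrib_left[symmetric])
  also have "\<dots> = prod P S - prod m S"
    using S Suc.prems(5)[of a] by (simp add: algebra_simps)
  finally show ?case .
qed

text \<open>For \<open>j\<close> in the upper set \<open>U\<close>, all elements below
  \<open>U\<close> contribute the constant factor \<open>m\<close>, so the sum telescopes within
  \<open>U\<close>. The sum over the complement follows by subtraction from the full one. Each of
  the two sums leaves its own boundary product.\<close>

lemma telescoping_products_upper:
  fixes P m :: "'a \<Rightarrow> 'b::comm_ring_1"
  assumes "finite S" and "asymp_on S R" and "transp_on S R" and "totalp_on S R"
    and "\<And>s. s \<in> S \<Longrightarrow> P s = m s + 1"
    and "U \<subseteq> S" and "\<And>s t. s \<in> S - U \<Longrightarrow> t \<in> U \<Longrightarrow> R s t"
  shows "(\<Sum>j\<in>U. (\<Prod>s\<in>S - {j}. if R j s then P s else m s))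
           = (\<Prod>s\<in>S. if s \<in> U then P s else m s) - prod m S"
    and "(\<Sum>j\<in>S - U. (\<Prod>s\<in>S - {j}. if R j s then P s else m s))
           = prod P S - (\<Prod>s\<in>S. if s \<in> U then P s else m s)"
proof -
  define D where "D = S - U"
  have S: "S = D \<union> U" "D \<inter> U = {}" and fin: "finite D" "finite U"
    using assms(1,6) finite_subset unfolding D_def by auto
  have R: "\<not> R t s" if "s \<in> D" "t \<in> U" for s t
    using assms(2,6,7) that unfolding D_def asymp_on_def by blast
  have "(\<Sum>j\<in>U. (\<Prod>s\<in>U - {j}. if R j s then P s else m s)) = prod P U - prod m U"
    by (rule telescoping_products)
       (use assms fin in \<open>auto intro: asymp_on_subset transp_on_subset totalp_on_subset\<close>)
  moreover have "(\<Prod>s\<in>S - {j}. if R j s then P s else m s)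
      = prod m D * (\<Prod>s\<in>U - {j}. if R j s then P s else m s)" if "j \<in> U" for j
  proof -
    have "S - {j} = D \<union> (U - {j})" using S that by auto
    moreover have "D \<inter> (U - {j}) = {}" using S by auto
    moreover have "(\<Prod>s\<in>D. if R j s then P s else m s) = prod m D"
      by (intro prod.cong refl) (simp add: R that)
    ultimately show ?thesis using fin by (simp add: prod.union_disjoint)
  qed
  moreover have split: "(\<Prod>s\<in>S. if s \<in> U then P s else m s) = prod m D * prod P U"
  proof -
    have "(\<Prod>s\<in>D. if s \<in> U then P s else m s) = prod m D"
      using S by (intro prod.cong) auto
    then show ?thesis using S fin by (simp add: prod.union_disjoint)
  qed
  moreover have "prod m S = prod m D * prod m U" using S fin by (simp add: prod.union_disjoint)
  ultimately show upper: "(\<Sum>j\<in>U. (\<Prod>s\<in>S - {j}. if R j s then P s else m s))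
      = (\<Prod>s\<in>S. if s \<in> U then P s else m s) - prod m S"
    by (simp add: sum_distrib_left[symmetric] right_diff_distrib)
  have "(\<Sum>j\<in>S. (\<Prod>s\<in>S - {j}. if R j s then P s else m s)) = prod P S - prod m S"
    by (rule telescoping_products) (use assms in auto)
  then show "(\<Sum>j\<in>S - U. (\<Prod>s\<in>S - {j}. if R j s then P s else m s))
      = prod P S - (\<Prod>s\<in>S. if s \<in> U then P s else m s)"
    using upper assms(1,6) by (simp add: sum_diff)
qed

section \<open>One elimination step\<close>

text \<open>The coordinates of the point \<open>y\<close> are themselves used as coefficients of the
  columns; \<open>reduced\<close> is what justifies this.\<close>

definition row_value :: "nat \<Rightarrow> rat mat \<Rightarrow> nat set \<Rightarrow> (nat \<Rightarrow> int) \<Rightarrow> nat \<Rightarrow> rat" where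
  "row_value n X J y k = X $$ (k, n) + (\<Sum>s\<in>{..<n} - J. X $$ (k, s) * of_int (y s))"

text \<open>Membership in the affine hull of the cone, as a fixed point condition: the point must be
  recovered from its own coordinates outside \<open>J\<close>.\<close>

definition on_flat :: "nat \<Rightarrow> rat mat \<Rightarrow> nat set \<Rightarrow> (nat \<Rightarrow> int) \<Rightarrow> bool" where
  "on_flat n X J y \<longleftrightarrow> (\<forall>k<n. of_int (y k) = row_value n X J y k)"

definition reduced :: "nat \<Rightarrow> rat mat \<Rightarrow> nat set \<Rightarrow> bool" where
  "reduced n X J \<longleftrightarrow> (\<forall>k\<in>{..<n} - J. X $$ (k, n) = 0 \<and>
     (\<forall>s\<in>{..<n} - J. X $$ (k, s) = of_bool (k = s)))"

definition orient :: "nat \<Rightarrow> rat mat \<Rightarrow> nat \<Rightarrow> int \<Rightarrow> rat" where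
  "orient n X s z = of_bool (0 \<le> z) - of_bool (\<not> lexpos n (\<lambda>k. X $$ (k, s)))"

section \<open>The effect of a pivot on rows and flats\<close>

lemma pivot_carrier [simp]: "X \<in> carrier_mat a b \<Longrightarrow> pivot n X i j \<in> carrier_mat a b"
  by (auto simp: pivot_def)

lemma pivot_index:
  assumes "X \<in> carrier_mat a b" "k < a" "s < b" "s \<noteq> j"
  shows "pivot n X i j $$ (k, s) = X $$ (k, s) - X $$ (n + i, s) / X $$ (n + i, j) * X $$ (k, j)"
  using assms by (auto simp: pivot_def)

text \<open>Column \<open>j\<close> vanishes in every row outside \<open>insert j J\<close>, so
  adding multiples of it leaves the identity block alone.\<close>

lemma pivot_reduced:
  assumes X: "X \<in> carrier_mat (n + r) (n + 1)" and red: "reduced n X J" and j: "j \<in> {..<n} - J"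
  shows "reduced n (pivot n X i j) (insert j J)"
  using red j unfolding reduced_def by (auto simp: pivot_index[OF X])

text \<open>Pivoting solves the equation of row \<open>n + i\<close> for \<open>y j\<close> and
  substitutes the result in row \<open>k\<close>. The correction is a multiple of the pivot row's
  value, hence vanishes wherever that equation holds.\<close>

lemma row_value_pivot:
  assumes X: "X \<in> carrier_mat (n + r) (n + 1)" and j: "j \<in> {..<n} - J"
    and p: "X $$ (n + i, j) \<noteq> 0" and k: "k < n + r"
  shows "row_value n X J y k = row_value n (pivot n X i j) (insert j J) y k
           + X $$ (k, j) / X $$ (n + i, j) * row_value n X J y (n + i)"
proof -
  define p where "p = X $$ (n + i, j)"
  define D where "D = {..<n} - insert j J"
  have C: "{..<n} - J = insert j D" "j \<notin> D" "finite D" using j unfolding D_def by auto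
  have "pivot n X i j $$ (k, s) = X $$ (k, s) - X $$ (n + i, s) / p * X $$ (k, j)" if "s \<in> insert n D" for s
    using that j unfolding p_def D_def by (intro pivot_index[OF X k]) auto
  then have "row_value n (pivot n X i j) (insert j J) y k
      = X $$ (k, n) - X $$ (n + i, n) / p * X $$ (k, j)
        + (\<Sum>s\<in>D. (X $$ (k, s) - X $$ (n + i, s) / p * X $$ (k, j)) * of_int (y s))"
    unfolding row_value_def D_def[symmetric] by (simp cong: sum.cong)
  also have "(\<Sum>s\<in>D. (X $$ (k, s) - X $$ (n + i, s) / p * X $$ (k, j)) * of_int (y s))
      = (\<Sum>s\<in>D. X $$ (k, s) * of_int (y s)) - X $$ (k, j) / p * (\<Sum>s\<in>D. X $$ (n + i, s) * of_int (y s))"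
    by (simp add: sum_distrib_left sum_subtractf[symmetric] algebra_simps)
  finally have pivoted: "row_value n (pivot n X i j) (insert j J) y k
      = X $$ (k, n) - X $$ (n + i, n) / p * X $$ (k, j) + ((\<Sum>s\<in>D. X $$ (k, s) * of_int (y s))
        - X $$ (k, j) / p * (\<Sum>s\<in>D. X $$ (n + i, s) * of_int (y s)))" .
  have row: "row_value n X J y l = X $$ (l, n) + (X $$ (l, j) * of_int (y j)
      + (\<Sum>s\<in>D. X $$ (l, s) * of_int (y s)))" for l
    unfolding row_value_def C(1) using C(2,3) by simp
  show ?thesis
    using p unfolding pivoted row[of k] row[of "n + i"] p_def[symmetric] by (simp add: field_simps)
qed

text \<open>The equation of row \<open>n + i\<close> leaves the list of constraints and reappears as
  the flat condition at coordinate \<open>j\<close>; where it holds, no other row changes its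
  value.\<close>

lemma pivot_flat_iff:
  assumes X: "X \<in> carrier_mat (n + r) (n + 1)" and red: "reduced n X J" and j: "j \<in> {..<n} - J"
    and p: "X $$ (n + i, j) \<noteq> 0" and i: "i \<in> {..<r} - I"
  shows "on_flat n (pivot n X i j) (insert j J) y \<and>
           (\<forall>l\<in>{..<r} - insert i I. row_value n (pivot n X i j) (insert j J) y (n + l) = 0)
         \<longleftrightarrow> on_flat n X J y \<and> (\<forall>l\<in>{..<r} - I. row_value n X J y (n + l) = 0)"
    (is "?L \<longleftrightarrow> ?R")
proof -
  note pivot_row = row_value_pivot[OF X j p, of _ y]
  have "row_value n X J y j = of_int (y j)"
  proof -
    have "(\<Sum>s\<in>{..<n} - J. X $$ (j, s) * of_int (y s)) = (\<Sum>s\<in>{..<n} - J. if j = s then of_int (y s) else 0)"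
      using red j unfolding reduced_def by (intro sum.cong) auto
    then show ?thesis using red j unfolding reduced_def row_value_def by simp
  qed
  \<comment> \<open>Before the pivot, row \<open>j\<close> has value \<open>y j\<close>; if it still
    has this value afterwards, the correction term must be zero.\<close>
  then have zero: "row_value n X J y (n + i) = 0" if ?L
    using that pivot_row[of j] red j p unfolding on_flat_def reduced_def by auto
  then have same: "row_value n (pivot n X i j) (insert j J) y k = row_value n X J y k"
    if "?L \<or> ?R" "k < n + r" for k
    using that i pivot_row[of k] by auto
  show ?thesis
  proof
    assume L: ?L
    note same = same[OF disjI1[OF L]]
    have "row_value n X J y (n + l) = 0" if "l \<in> {..<r} - I" for l
      using that same[of "n + l"] zero[OF L] L by (cases "l = i") auto
    then show ?R using L same by (simp add: on_flat_def)
  next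
    assume R: ?R
    note same = same[OF disjI2[OF R]]
    show ?L using R same by (simp add: on_flat_def)
  qed
qed

text \<open>Multiplying by \<open>p\<close> and dividing by \<open>p\<close> differ by the positive
  factor \<open>p * p\<close>. Division is preferred because it scales all columns to pivot item 1,
  which makes them comparable with each other.\<close>

lemma contributing_iff:
  assumes X: "X \<in> carrier_mat (n + r) (n + 1)" and red: "reduced n X J" and j: "j \<in> {..<n} - J"
  shows "contributing n X I i j \<longleftrightarrow>
           X $$ (n + i, j) \<noteq> 0 \<and> lexpos n (\<lambda>k. X $$ (k, j) / X $$ (n + i, j))"
    and "dually_contributing n X I i j \<longleftrightarrow>
           X $$ (n + i, j) \<noteq> 0 \<and> \<not> lexpos n (\<lambda>k. X $$ (k, j) / X $$ (n + i, j))"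
proof -
  define p where "p = X $$ (n + i, j)"
  \<comment> \<open>Ignored rows all have index at least \<open>n\<close>, so the top block is kept
    whole.\<close>
  have "filter (\<lambda>k. k \<notin> (\<lambda>i. n + i) ` I) [0..<n] = [0..<n]"
    by (rule filter_True) auto
  then have split: "map ((*) p) (active_column n X I j) = map (\<lambda>k. p * X $$ (k, j)) [0..<n] @
      map (\<lambda>k. p * X $$ (k, j)) (filter (\<lambda>k. k \<notin> (\<lambda>i. n + i) ` I) [n..<n + r])"
    using X upt_add_eq_append[of 0 n r] by (simp add: active_column_def)
  have "small (map ((*) p) (active_column n X I j)) \<longleftrightarrow> lexpos n (\<lambda>k. X $$ (k, j) / p)" if "p \<noteq> 0"
  proof -
    have "small (map ((*) p) (active_column n X I j)) \<longleftrightarrow> lexpos n (\<lambda>k. p * X $$ (k, j))"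
      unfolding split by (rule small_append_iff_lexpos[of j]) (use j red that in \<open>auto simp: reduced_def\<close>)
    also have "(\<lambda>k. p * X $$ (k, j)) = (\<lambda>k. (p * p) * (X $$ (k, j) / p))"
      using that by auto
    also have "lexpos n \<dots> \<longleftrightarrow> lexpos n (\<lambda>k. X $$ (k, j) / p)"
      by (rule lexpos_scale) (use that in \<open>auto simp: zero_less_mult_iff\<close>)
    finally show ?thesis .
  qed
  then show "contributing n X I i j \<longleftrightarrow>
           X $$ (n + i, j) \<noteq> 0 \<and> lexpos n (\<lambda>k. X $$ (k, j) / X $$ (n + i, j))"
    and "dually_contributing n X I i j \<longleftrightarrow>
           X $$ (n + i, j) \<noteq> 0 \<and> \<not> lexpos n (\<lambda>k. X $$ (k, j) / X $$ (n + i, j))"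
    unfolding contributing_def dually_contributing_def p_def by auto
qed

text \<open>A negative factor reverses the lexicographic sign and exchanges an indicator with its
  complement. Pulling out \<open>sgn c\<close> therefore leaves one of two values that differ by 1,
  as the telescoping identity requires.\<close>

lemma orient_scaled:
  assumes "l < n" "f l \<noteq> 0" "c \<noteq> 0"
  shows "of_bool (0 \<le> z) - of_bool (\<not> lexpos n (\<lambda>k. c * f k)) =
           sgn c * ((if 0 < c then of_bool (0 \<le> z) else 1 - of_bool (0 \<le> z)) - of_bool (\<not> lexpos n f))"
proof (cases "0 < c")
  case True
  then show ?thesis by (simp add: lexpos_scale)
next
  case False
  then have "lexpos n (\<lambda>k. c * f k) \<longleftrightarrow> lexpos n (\<lambda>k. - f k)"
    using assms(3) lexpos_scale[of "- c" n "\<lambda>k. - f k"] by simp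
  also have "\<dots> \<longleftrightarrow> \<not> lexpos n f"
    using lexpos_cases[of l n f, OF assms(1,2)] not_lexpos_uminus[of n f] by blast
  finally show ?thesis using False assms(3) by (auto simp: sgn_if)
qed

text \<open>Up to a factor common to all \<open>j\<close>, each summand is a summand of the
  telescoping identity. The equation of the pivot row, combined with the inequality on
  \<open>lambda_deg\<close> or \<open>lambda_ord\<close>, makes the respective boundary product
  vanish.\<close>

lemma orient_elimination:
  fixes y :: "nat \<Rightarrow> int"
  assumes X: "X \<in> carrier_mat (n + r) (n + 1)" and red: "reduced n X J"
    and zero: "row_value n X J y (n + i) = 0"
  defines "C \<equiv> {..<n} - J"
  defines "summand \<equiv> \<lambda>j. sgn (X $$ (n + i, j)) * (\<Prod>s\<in>C - {j}. orient n (pivot n X i j) s (y s))"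
  shows "lambda_deg n X J i < 0 \<Longrightarrow>
           (\<Sum>j\<in>{j\<in>C. contributing n X I i j}. summand j) = (\<Prod>s\<in>C. orient n X s (y s))"
    and "lambda_ord n X J i < 0 \<Longrightarrow>
           (\<Sum>j\<in>{j\<in>C. dually_contributing n X I i j}. summand j) = - (\<Prod>s\<in>C. orient n X s (y s))"
proof -
  define p where "p s = X $$ (n + i, s)" for s
  define S where "S = {s\<in>C. p s \<noteq> 0}"
  define Z where "Z = {s\<in>C. p s = 0}"
  define u where "u s k = X $$ (k, s) / p s" for s k
  \<comment> \<open>Columns scaled to pivot item 1 are compared lexicographically. They are pairwise
    distinct, because row \<open>s\<close> is nonzero in \<open>u s\<close> and zero in every other
    \<open>u t\<close>.\<close>
  define R where "R s t \<longleftrightarrow> lexpos n (\<lambda>k. u t k - u s k)" for s t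
  define U where "U = {s\<in>S. lexpos n (u s)}"
  \<comment> \<open>For a negative pivot item the two half-lines trade places, so \<open>m s\<close>
    is always minus the indicator of the half-line complementary to that of
    \<open>P s\<close>.\<close>
  define P :: "nat \<Rightarrow> rat" where
    "P s = (if 0 < p s then of_bool (0 \<le> y s) else 1 - of_bool (0 \<le> y s))" for s
  define m where "m s = P s - 1" for s
  have fin: "finite C" "finite S" "finite Z" unfolding C_def S_def Z_def by auto
  have C: "C = Z \<union> S" "Z \<inter> S = {}" unfolding S_def Z_def by auto
  have unit: "X $$ (s, t) = of_bool (s = t)" "s < n" if "s \<in> C" "t \<in> C" for s t
    using that red unfolding reduced_def C_def by auto
  have asym: "asymp_on S R"
    unfolding asymp_on_def R_def using not_lexpos_uminus[of n "\<lambda>k. u _ k - u _ k"] by simp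
  have trans: "transp_on S R"
  proof (rule transp_onI)
    fix a b c assume "R a b" "R b c"
    from lexpos_add[OF this[unfolded R_def]] show "R a c" unfolding R_def by simp
  qed
  have distinct_at: "u t s - u s s \<noteq> 0" if "s \<in> S" "t \<in> S" "s \<noteq> t" for s t
    using that unit unfolding S_def u_def by auto
  have total: "totalp_on S R"
  proof (rule totalp_onI)
    fix s t assume st: "s \<in> S" "t \<in> S" "s \<noteq> t"
    then show "R s t \<or> R t s"
      using lexpos_cases[of s n "\<lambda>k. u t k - u s k"] distinct_at[OF st] unit[of s s]
      unfolding R_def S_def by auto
  qed
  have nonzero_at: "u s s \<noteq> 0" "s < n" if "s \<in> S" for s
    using that unit[of s s] unfolding S_def u_def by auto
  have upper: "R s t" if "s \<in> S - U" "t \<in> U" for s t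
  proof -
    have "lexpos n (\<lambda>k. - u s k)"
      using that(1) lexpos_cases[of s n "u s"] nonzero_at[of s] unfolding U_def by blast
    then show ?thesis
      using lexpos_add[of n "u t" "\<lambda>k. - u s k"] that(2) unfolding U_def R_def by simp
  qed
  have U: "U \<subseteq> S" unfolding U_def by auto
  have Pm: "P s = m s + 1" if "s \<in> S" for s unfolding m_def by simp
  have before: "orient n X s (y s) = sgn (p s) * (if s \<in> U then P s else m s)" if "s \<in> S" for s
  proof -
    have "(\<lambda>k. X $$ (k, s)) = (\<lambda>k. p s * u s k)" using that unfolding S_def u_def by auto
    then show ?thesis
      using orient_scaled[of s n "u s" "p s" "y s"] nonzero_at[OF that] that
      unfolding orient_def P_def m_def U_def S_def by auto
  qed
  have column: "lexpos n (\<lambda>k. pivot n X i j $$ (k, s)) \<longleftrightarrow> lexpos n (\<lambda>k. X $$ (k, s) - p s / p j * X $$ (k, j))"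
    if "j \<in> S" "s \<in> C - {j}" for j s
    using that unfolding C_def p_def by (intro lexpos_cong) (auto simp: pivot_index[OF X])
  \<comment> \<open>After the pivot, column \<open>s\<close> is \<open>p s\<close> times the
    difference \<open>u s - u j\<close>, whose sign is what \<open>R j s\<close> records.\<close>
  have after: "orient n (pivot n X i j) s (y s) = sgn (p s) * (if R j s then P s else m s)"
    if "j \<in> S" "s \<in> S - {j}" for j s
  proof -
    have "(\<lambda>k. X $$ (k, s) - p s / p j * X $$ (k, j)) = (\<lambda>k. p s * (u s k - u j k))"
      using that unfolding S_def u_def by (auto simp: field_simps)
    moreover have "u s j - u j j \<noteq> 0" "j < n" "p s \<noteq> 0"
      using distinct_at[of j s] that nonzero_at[of j] unfolding S_def by auto
    moreover have "s \<in> C - {j}" using that unfolding S_def by auto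
    ultimately show ?thesis
      using orient_scaled[of j n "\<lambda>k. u s k - u j k" "p s" "y s"] column[OF that(1)]
      unfolding orient_def P_def m_def R_def by auto
  qed
  have unchanged: "orient n (pivot n X i j) s (y s) = orient n X s (y s)" if "j \<in> S" "s \<in> Z" for j s
  proof -
    have "s \<in> C - {j}" "p s = 0" using that unfolding S_def Z_def by auto
    then show ?thesis using column[OF that(1)] unfolding orient_def by simp
  qed
  \<comment> \<open>The sign of \<open>p j\<close> in \<open>summand j\<close> supplies the one
    factor missing from the product of signs over \<open>S - {j}\<close>, so \<open>c\<close> does
    not depend on \<open>j\<close>.\<close>
  define c where "c = (\<Prod>s\<in>Z. orient n X s (y s)) * (\<Prod>s\<in>S. sgn (p s))"
  have summand: "summand j = c * (\<Prod>s\<in>S - {j}. if R j s then P s else m s)" if "j \<in> S" for j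
  proof -
    have "C - {j} = Z \<union> (S - {j})" "Z \<inter> (S - {j}) = {}" using C that by auto
    then have "summand j = sgn (p j) * ((\<Prod>s\<in>Z. orient n (pivot n X i j) s (y s)) *
        (\<Prod>s\<in>S - {j}. orient n (pivot n X i j) s (y s)))"
      unfolding summand_def p_def[symmetric] using fin by (simp add: prod.union_disjoint)
    also have "\<dots> = sgn (p j) * ((\<Prod>s\<in>Z. orient n X s (y s)) *
        (\<Prod>s\<in>S - {j}. sgn (p s) * (if R j s then P s else m s)))"
      by (intro arg_cong2[of _ _ _ _ "(*)"] prod.cong refl unchanged[OF that] after[OF that])
    also have "\<dots> = c * (\<Prod>s\<in>S - {j}. if R j s then P s else m s)"
      unfolding c_def prod.remove[OF fin(2) that] prod.distrib by (simp only: mult_ac)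
    finally show ?thesis .
  qed
  have full: "(\<Prod>s\<in>C. orient n X s (y s)) = c * (\<Prod>s\<in>S. if s \<in> U then P s else m s)"
  proof -
    have "(\<Prod>s\<in>C. orient n X s (y s)) = (\<Prod>s\<in>Z. orient n X s (y s)) * (\<Prod>s\<in>S. orient n X s (y s))"
      unfolding C(1) using fin C(2) by (simp add: prod.union_disjoint)
    also have "(\<Prod>s\<in>S. orient n X s (y s)) = (\<Prod>s\<in>S. sgn (p s) * (if s \<in> U then P s else m s))"
      by (intro prod.cong refl before)
    finally show ?thesis unfolding c_def prod.distrib by (simp only: mult.assoc)
  qed
  have sums: "(\<Sum>j\<in>W. summand j) = c * (\<Sum>j\<in>W. \<Prod>s\<in>S - {j}. if R j s then P s else m s)"
    if "W \<subseteq> S" for W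
    unfolding sum_distrib_left by (intro sum.cong refl summand) (use that in blast)
  note telescope = telescoping_products_upper[OF fin(2) asym trans total Pm U upper]
  have balance: "X $$ (n + i, n) + (\<Sum>s\<in>C. p s * of_int (y s)) = 0"
    using zero unfolding row_value_def C_def p_def by simp
  show "(\<Sum>j\<in>{j\<in>C. contributing n X I i j}. summand j) = (\<Prod>s\<in>C. orient n X s (y s))"
    if deg: "lambda_deg n X J i < 0"
  proof -
    have "prod m S = 0"
    proof (rule ccontr)
      \<comment> \<open>All factors nonzero means \<open>y s < 0\<close> where
        \<open>p s > 0\<close> and \<open>y s \<ge> 0\<close> where \<open>p s < 0\<close>.
        Integrality sharpens the former to \<open>y s \<le> - 1\<close>, so the left side of
        \<open>balance\<close> is at most \<open>lambda_deg n X J i\<close>, which is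
        negative.\<close>
      assume "prod m S \<noteq> 0"
      then have m: "m s \<noteq> 0" if "s \<in> S" for s using that fin by auto
      have "p s * of_int (y s) \<le> (if 0 < p s then - p s else 0)" if "s \<in> C" for s
      proof (cases "p s = 0")
        case False
        then have "m s \<noteq> 0" using m that unfolding S_def by blast
        then have "if 0 < p s then y s \<le> - 1 else 0 \<le> y s"
          unfolding m_def P_def by (auto split: if_splits)
        then have "if 0 < p s then (of_int (y s) :: rat) \<le> - 1 else 0 \<le> (of_int (y s) :: rat)"
          by (auto split: if_splits)
        then show ?thesis
          using mult_left_mono[of "of_int (y s) :: rat" "- 1" "p s"]
          by (auto split: if_splits simp: mult_nonpos_nonneg)
      qed simp
      then have "(\<Sum>s\<in>C. p s * of_int (y s)) \<le> (\<Sum>s\<in>C. if 0 < p s then - p s else 0)"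
        by (rule sum_mono)
      also have "\<dots> = - (\<Sum>s\<in>{s\<in>C. 0 < p s}. p s)"
        using fin(1) by (simp add: sum.inter_filter sum_negf[symmetric] if_distrib cong: if_cong)
      finally show False using deg balance unfolding lambda_deg_def C_def p_def by simp
    qed
    moreover have "{j\<in>C. contributing n X I i j} = U"
      using contributing_iff(1)[OF X red] unfolding U_def S_def C_def u_def p_def by auto
    ultimately show ?thesis
      using telescope(1) sums[OF U] by (simp add: full)
  qed
  show "(\<Sum>j\<in>{j\<in>C. dually_contributing n X I i j}. summand j) = - (\<Prod>s\<in>C. orient n X s (y s))"
    if ord: "lambda_ord n X J i < 0"
  proof -
    have "prod P S = 0"
    proof (rule ccontr)
      \<comment> \<open>Here the half-lines are the opposite ones, and the left side of
        \<open>balance\<close> is at least \<open>- lambda_ord n X J i\<close>, which is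
        positive.\<close>
      assume "prod P S \<noteq> 0"
      then have P: "P s \<noteq> 0" if "s \<in> S" for s using that fin by auto
      have "(if p s < 0 then - p s else 0) \<le> p s * of_int (y s)" if "s \<in> C" for s
      proof (cases "p s = 0")
        case False
        then have "P s \<noteq> 0" using P that unfolding S_def by blast
        then have "if p s < 0 then y s \<le> - 1 else 0 \<le> y s"
          using False unfolding P_def by (auto split: if_splits)
        then have "if p s < 0 then (of_int (y s) :: rat) \<le> - 1 else 0 \<le> (of_int (y s) :: rat)"
          by (auto split: if_splits)
        then show ?thesis
          using mult_left_mono_neg[of "of_int (y s) :: rat" "- 1" "p s"]
          by (auto split: if_splits)
      qed simp
      then have "(\<Sum>s\<in>C. if p s < 0 then - p s else 0) \<le> (\<Sum>s\<in>C. p s * of_int (y s))"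
        by (rule sum_mono)
      moreover have "(\<Sum>s\<in>C. if p s < 0 then - p s else 0) = - (\<Sum>s\<in>{s\<in>C. p s < 0}. p s)"
        using fin(1) by (simp add: sum.inter_filter sum_negf[symmetric] if_distrib cong: if_cong)
      ultimately show False using ord balance unfolding lambda_ord_def C_def p_def by simp
    qed
    moreover have "{j\<in>C. dually_contributing n X I i j} = S - U"
      using contributing_iff(2)[OF X red] unfolding U_def S_def C_def u_def p_def by auto
    ultimately show ?thesis
      using telescope(2) sums[of "S - U"] by (simp add: full)
  qed
qed

section \<open>Conservation of the signed weight\<close>

definition term_weight :: "nat \<Rightarrow> nat \<Rightarrow> cone_term \<Rightarrow> (nat \<Rightarrow> int) \<Rightarrow> rat" where
  "term_weight n r = (\<lambda>(s, X, I, J) y.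
     if on_flat n X J y \<and> (\<forall>l\<in>{..<r} - I. row_value n X J y (n + l) = 0)
     then of_int s * (\<Prod>t\<in>{..<n} - J. orient n X t (y t)) else 0)"

text \<open>The left side has the shape to which the list comprehensions in \<open>eliminate\<close>
  unfold.\<close>

lemma sum_list_concat_guarded:
  "(\<Sum>x\<leftarrow>concat (map (\<lambda>j. if Q j then [g j] else []) [0..<n]). f x) = (\<Sum>j\<in>{j\<in>{..<n}. Q j}. f (g j))"
proof (induction n)
  case (Suc n)
  have "{j\<in>{..<Suc n}. Q j} = (if Q n then insert n {j\<in>{..<n}. Q j} else {j\<in>{..<n}. Q j})"
    by (auto simp: less_Suc_eq)
  then show ?case using Suc by (auto simp: add.commute)
qed simp

lemma of_int_sign: "of_int (sign x) = sgn x"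
  by (simp add: sign_def sgn_if)

text \<open>By \<open>pivot_flat_iff\<close> a term and all its successors live on the same integer
  points; there \<open>orient_elimination\<close> equates the values.\<close>

lemma term_weight_eliminate:
  assumes X: "X \<in> carrier_mat (n + r) (n + 1)" and red: "reduced n X J"
    and legal: "legal_choice n r (s, X, I, J) (i, \<phi>)"
  shows "(\<Sum>T\<leftarrow>eliminate n (s, X, I, J) (i, \<phi>). term_weight n r T y) = term_weight n r (s, X, I, J) y"
proof -
  define C where "C = {..<n} - J"
  define ok where "ok \<longleftrightarrow> on_flat n X J y \<and> (\<forall>l\<in>{..<r} - I. row_value n X J y (n + l) = 0)"
  \<comment> \<open>The minus sign of the dual formula in the algorithm meets the minus sign in
    \<open>orient_elimination\<close>; they cancel as
    \<open>\<epsilon> * \<epsilon> = 1\<close>.\<close>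
  define \<epsilon> :: int where "\<epsilon> = (case \<phi> of Contributing \<Rightarrow> 1 | Dual \<Rightarrow> - 1)"
  define Q where "Q = (case \<phi> of Contributing \<Rightarrow> contributing n X I i | Dual \<Rightarrow> dually_contributing n X I i)"
  have i: "i \<in> {..<r} - I" using legal by simp
  have weight: "term_weight n r (s * \<epsilon> * sign (X $$ (n + i, j)), pivot n X i j, insert i I, insert j J) y
      = (if ok then of_int (s * \<epsilon>) * (sgn (X $$ (n + i, j)) * (\<Prod>t\<in>C - {j}. orient n (pivot n X i j) t (y t))) else 0)"
    if "j \<in> C" "Q j" for j
  proof -
    have p: "X $$ (n + i, j) \<noteq> 0"
      using that(2) unfolding Q_def by (cases \<phi>) (simp_all add: contributing_def dually_contributing_def)
    have "{..<n} - insert j J = C - {j}" unfolding C_def by auto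
    then show ?thesis
      using pivot_flat_iff[OF X red that(1)[unfolded C_def] p i, of y]
      unfolding term_weight_def ok_def by (simp add: of_int_sign)
  qed
  have "eliminate n (s, X, I, J) (i, \<phi>) = concat (map (\<lambda>j. if j \<notin> J \<and> Q j
      then [(s * \<epsilon> * sign (X $$ (n + i, j)), pivot n X i j, insert i I, insert j J)] else []) [0..<n])"
    unfolding \<epsilon>_def Q_def by (cases \<phi>) (simp_all cong: if_cong)
  then have "(\<Sum>T\<leftarrow>eliminate n (s, X, I, J) (i, \<phi>). term_weight n r T y)
      = (\<Sum>j\<in>{j\<in>{..<n}. j \<notin> J \<and> Q j}.
          term_weight n r (s * \<epsilon> * sign (X $$ (n + i, j)), pivot n X i j, insert i I, insert j J) y)"
    by (simp only: sum_list_concat_guarded)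
  also have "{j\<in>{..<n}. j \<notin> J \<and> Q j} = {j\<in>C. Q j}" unfolding C_def by auto
  also have "(\<Sum>j\<in>{j\<in>C. Q j}. term_weight n r (s * \<epsilon> * sign (X $$ (n + i, j)), pivot n X i j, insert i I, insert j J) y)
      = (if ok then of_int (s * \<epsilon>) *
          (\<Sum>j\<in>{j\<in>C. Q j}. sgn (X $$ (n + i, j)) * (\<Prod>t\<in>C - {j}. orient n (pivot n X i j) t (y t))) else 0)"
    by (simp add: weight sum_distrib_left)
  also have "\<dots> = term_weight n r (s, X, I, J) y"
  proof (cases ok)
    case True
    then have zero: "row_value n X J y (n + i) = 0" using i unfolding ok_def by blast
    have "(\<Sum>j\<in>{j\<in>C. Q j}. sgn (X $$ (n + i, j)) * (\<Prod>t\<in>C - {j}. orient n (pivot n X i j) t (y t)))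
        = of_int \<epsilon> * (\<Prod>t\<in>C. orient n X t (y t))"
      using orient_elimination[OF X red zero, of I] legal
      unfolding C_def Q_def \<epsilon>_def by (cases \<phi>) auto
    moreover have "\<epsilon> * \<epsilon> = 1" unfolding \<epsilon>_def by (cases \<phi>) auto
    ultimately show ?thesis
      using True unfolding term_weight_def ok_def C_def
      by (simp add: mult.assoc[symmetric] of_int_mult[symmetric] del: of_int_mult)
  next
    case False
    then show ?thesis unfolding term_weight_def ok_def by auto
  qed
  finally show ?thesis .
qed

section \<open>Generating functions of cones\<close>

text \<open>One shape covers the lattice series of a cone, its oriented variant and the finite
  numerator; they differ only in the one-variable weights \<open>\<psi>\<close>.\<close>

definition box_series :: "nat \<Rightarrow> rat mat \<Rightarrow> nat set \<Rightarrow> (nat \<Rightarrow> int \<Rightarrow> rat) \<Rightarrow> series" where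
  "box_series n X J \<psi> e =
     (if Poly_Mapping.keys e \<subseteq> {..<n} \<and> on_flat n X J (Poly_Mapping.lookup e)
      then \<Prod>s\<in>{..<n} - J. \<psi> s (Poly_Mapping.lookup e s) else 0)"

section \<open>Integer multiples of the generators\<close>

lemma common_denominator:
  assumes "finite Q"
  shows "\<exists>N::int. 0 < N \<and> (\<forall>x\<in>Q. \<exists>z. of_int N * (x::rat) = of_int z)"
  using assms
proof (induction Q)
  case empty
  show ?case by (rule exI[of _ 1]) simp
next
  case (insert x Q)
  then obtain N where N: "0 < N" "\<forall>x\<in>Q. \<exists>z. of_int N * x = of_int z" by blast
  obtain a b where "quotient_of x = (a, b)" by force
  then have x: "0 < b" "x = of_int a / of_int b"
    using quotient_of_denom_pos quotient_of_div by blast+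
  have "\<exists>z. of_int (N * b) * w = of_int z" if w: "w \<in> insert x Q" for w
  proof (cases "w = x")
    case True
    then show ?thesis using x by (intro exI[of _ "N * a"]) simp
  next
    case False
    then obtain z where "of_int N * w = of_int z" using N w by blast
    then show ?thesis by (intro exI[of _ "b * z"]) (simp add: mult.commute mult.left_commute)
  qed
  then show ?case using N(1) x(1) by (intro exI[of _ "N * b"]) auto
qed

lemma exponent_exists:
  "\<exists>e::exponent. Poly_Mapping.keys e \<subseteq> {..<n} \<and> (\<forall>k<n. Poly_Mapping.lookup e k = g k)"
proof -
  define e :: exponent where "e = (\<Sum>k<n. Poly_Mapping.single k (g k))"
  have "Poly_Mapping.lookup e k = (if k < n then g k else 0)" for k
    unfolding e_def by (simp add: lookup_sum lookup_single when_def)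
  then show ?thesis by (intro exI[of _ e]) (auto simp: in_keys_iff split: if_splits)
qed

lemma keys_diff_subset_iff:
  fixes e w :: exponent
  assumes "Poly_Mapping.keys w \<subseteq> K"
  shows "Poly_Mapping.keys (e - w) \<subseteq> K \<longleftrightarrow> Poly_Mapping.keys e \<subseteq> K"
  using keys_diff[of e w] keys_add[of "e - w" w] assms by auto

text \<open>A shift by \<open>N\<close> times column \<open>a\<close> preserves the flat. Because of
  the unit rows it moves only coordinate \<open>a\<close> among those outside \<open>J\<close>, so
  the difference acts on a single factor of the product.\<close>

lemma box_series_difference:
  assumes red: "reduced n X J" and a: "a \<in> {..<n} - J"
    and w: "Poly_Mapping.keys w \<subseteq> {..<n}" "\<forall>k<n. of_int (Poly_Mapping.lookup w k) = of_int N * X $$ (k, a)"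
  shows "(\<lambda>e. box_series n X J \<psi> e - box_series n X J \<psi> (e - w))
           = box_series n X J (\<psi>(a := \<lambda>x. \<psi> a x - \<psi> a (x - N)))"
proof
  fix e
  define C where "C = {..<n} - J"
  have C: "finite C" "a \<in> C" using a unfolding C_def by auto
  have unit: "X $$ (s, a) = of_bool (s = a)" "s < n" if "s \<in> C" for s
    using that a red unfolding reduced_def C_def by auto
  have coord: "Poly_Mapping.lookup w s = (if s = a then N else 0)" if "s \<in> C" for s
    using w(2) unit[OF that] by (auto simp: of_int_eq_iff[symmetric, where 'a = rat] simp del: of_int_eq_iff)
  have "row_value n X J (Poly_Mapping.lookup (e - w)) k
      = row_value n X J (Poly_Mapping.lookup e) k - of_int N * X $$ (k, a)" for k
  proof -
    have "(\<Sum>s\<in>C. X $$ (k, s) * of_int (Poly_Mapping.lookup w s)) = (\<Sum>s\<in>C. if s = a then X $$ (k, a) * of_int N else 0)"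
      by (intro sum.cong) (auto simp: coord)
    also have "\<dots> = of_int N * X $$ (k, a)" using C by simp
    finally show ?thesis
      unfolding row_value_def C_def[symmetric]
      by (simp add: lookup_minus right_diff_distrib sum_subtractf)
  qed
  then have flat: "on_flat n X J (Poly_Mapping.lookup (e - w)) \<longleftrightarrow> on_flat n X J (Poly_Mapping.lookup e)"
    using w(2) unfolding on_flat_def by (simp add: lookup_minus)
  define rest where "rest = (\<Prod>s\<in>C - {a}. \<psi> s (Poly_Mapping.lookup e s))"
  have "(\<Prod>s\<in>C. \<psi> s (Poly_Mapping.lookup e s)) = \<psi> a (Poly_Mapping.lookup e a) * rest"
    unfolding rest_def by (rule prod.remove[OF C])
  moreover have "(\<Prod>s\<in>C. \<psi> s (Poly_Mapping.lookup (e - w) s)) = \<psi> a (Poly_Mapping.lookup e a - N) * rest"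
  proof -
    have "(\<Prod>s\<in>C - {a}. \<psi> s (Poly_Mapping.lookup (e - w) s)) = rest"
      unfolding rest_def by (intro prod.cong) (auto simp: lookup_minus coord)
    then show ?thesis using C by (simp add: prod.remove[OF C] lookup_minus coord)
  qed
  moreover have "(\<Prod>s\<in>C. (\<psi>(a := \<lambda>x. \<psi> a x - \<psi> a (x - N))) s (Poly_Mapping.lookup e s))
      = (\<psi> a (Poly_Mapping.lookup e a) - \<psi> a (Poly_Mapping.lookup e a - N)) * rest"
  proof -
    have "(\<Prod>s\<in>C - {a}. (\<psi>(a := \<lambda>x. \<psi> a x - \<psi> a (x - N))) s (Poly_Mapping.lookup e s)) = rest"
      unfolding rest_def by (intro prod.cong) auto
    then show ?thesis by (simp add: prod.remove[OF C])
  qed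
  ultimately show "box_series n X J \<psi> e - box_series n X J \<psi> (e - w)
      = box_series n X J (\<psi>(a := \<lambda>x. \<psi> a x - \<psi> a (x - N))) e"
    unfolding box_series_def C_def[symmetric] flat keys_diff_subset_iff[OF w(1)]
    by (simp add: left_diff_distrib)
qed

text \<open>A point of the flat is determined by its coordinates outside \<open>J\<close>, and here
  these range over a finite box.\<close>

lemma finite_support_box_series:
  "finite {e. box_series n X J (\<lambda>_ x. of_bool (0 \<le> x \<and> x < N)) e \<noteq> 0}" (is "finite ?S")
proof (rule finite_imageD)
  let ?C = "{..<n} - J"
  let ?g = "\<lambda>e::exponent. restrict (Poly_Mapping.lookup e) ?C"
  have "?g ` ?S \<subseteq> (\<Pi>\<^sub>E s\<in>?C. {0..<N})"
    by (auto simp: box_series_def split: if_splits)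
  then show "finite (?g ` ?S)" by (rule finite_subset) (simp add: finite_PiE)
  show "inj_on ?g ?S"
  proof (rule inj_onI)
    fix e f assume e: "e \<in> ?S" and f: "f \<in> ?S" and eq: "?g e = ?g f"
    have flat: "Poly_Mapping.keys h \<subseteq> {..<n}" "on_flat n X J (Poly_Mapping.lookup h)" if "h \<in> ?S" for h
      using that by (auto simp: box_series_def split: if_splits)
    have "Poly_Mapping.lookup e s = Poly_Mapping.lookup f s" if "s \<in> ?C" for s
      using fun_cong[OF eq, of s] that by simp
    then have "row_value n X J (Poly_Mapping.lookup e) k = row_value n X J (Poly_Mapping.lookup f) k" for k
      unfolding row_value_def by (intro arg_cong2[of _ _ _ _ "(+)"] sum.cong refl) simp
    then have "of_int (Poly_Mapping.lookup e k) = (of_int (Poly_Mapping.lookup f k) :: rat)" if "k < n" for k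
      using flat[OF e] flat[OF f] that unfolding on_flat_def by simp
    moreover have "Poly_Mapping.lookup e k = 0" "Poly_Mapping.lookup f k = 0" if "\<not> k < n" for k
      using flat(1)[OF e] flat(1)[OF f] that by (auto simp: in_keys_iff subset_iff)
    ultimately show "e = f" by (intro poly_mapping_eqI) (metis of_int_eq_iff)
  qed
qed

text \<open>
  The difference in direction of each generator does not see the constants \<open>c s\<close>; this is how
  reversing a generator, with a change of sign, leaves the rational function unchanged.
\<close>

lemma represents_box_series:
  assumes red: "reduced n X J"
  obtains F where "\<And>c. represents F (box_series n X J (\<lambda>s x. of_bool (0 \<le> x) - c s))"
proof -
  define C where "C = {..<n} - J"
  obtain N :: int where N: "0 < N" and "\<forall>x\<in>(\<lambda>(k, s). X $$ (k, s)) ` ({..<n} \<times> {..<n}). \<exists>z. of_int N * x = of_int z"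
    using common_denominator[of "(\<lambda>(k, s). X $$ (k, s)) ` ({..<n} \<times> {..<n})"] by auto
  then have "\<forall>k\<in>{..<n}. \<forall>s\<in>{..<n}. \<exists>z. of_int N * X $$ (k, s) = of_int z" by auto
  then obtain g where g: "\<And>k s. k < n \<Longrightarrow> s < n \<Longrightarrow> of_int N * X $$ (k, s) = of_int (g k s)"
    by (metis lessThan_iff)
  obtain w :: "nat \<Rightarrow> exponent" where w: "\<And>s. Poly_Mapping.keys (w s) \<subseteq> {..<n}"
      "\<And>s k. k < n \<Longrightarrow> Poly_Mapping.lookup (w s) k = g k s"
    using exponent_exists[of n "\<lambda>k. g k _"] by metis
  \<comment> \<open>The exponent \<open>w s\<close> is \<open>N\<close> times column
    \<open>s\<close>, hence has entry \<open>N\<close> at \<open>s\<close>.\<close>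
  have "w s \<noteq> 0" if "s \<in> C" for s
  proof
    assume "w s = 0"
    then have "of_int N * X $$ (s, s) = 0" using w(2)[of s s] g[of s s] that unfolding C_def by simp
    then show False using red that N unfolding C_def reduced_def by auto
  qed
  define q where "q D = (\<Prod>s\<in>D. 1 - Poly_Mapping.single (w s) 1 :: laurent)" for D
  have "q C \<noteq> 0"
    unfolding q_def using one_minus_monomial_nonzero \<open>\<And>s. s \<in> C \<Longrightarrow> w s \<noteq> 0\<close>
    by (simp add: C_def)
  have step: "laurent_times (q D) (box_series n X J \<psi>)
      = box_series n X J (\<lambda>s x. if s \<in> D then \<psi> s x - \<psi> s (x - N) else \<psi> s x)"
    if "finite D" "D \<subseteq> C" for D \<psi>
    using that
  proof (induction D)
    case empty
    show ?case by (simp add: q_def laurent_times_one)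
  next
    case (insert a D)
    define \<chi> where "\<chi> = (\<lambda>s x. if s \<in> D then \<psi> s x - \<psi> s (x - N) else \<psi> s x)"
    have "laurent_times (q (insert a D)) (box_series n X J \<psi>)
        = laurent_times (1 - Poly_Mapping.single (w a) 1) (box_series n X J \<chi>)"
      using insert unfolding q_def \<chi>_def by (simp add: laurent_times_mult)
    also have "\<dots> = box_series n X J (\<chi>(a := \<lambda>x. \<chi> a x - \<chi> a (x - N)))"
      unfolding laurent_times_one_minus_monomial
      by (rule box_series_difference[OF red]) (use insert w g in \<open>auto simp: C_def\<close>)
    also have "\<chi>(a := \<lambda>x. \<chi> a x - \<chi> a (x - N))
        = (\<lambda>s x. if s \<in> insert a D then \<psi> s x - \<psi> s (x - N) else \<psi> s x)"
      using insert.hyps(2) unfolding \<chi>_def by auto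
    finally show ?case .
  qed
  \<comment> \<open>The weight \<open>[x \<ge> 0] - [x \<ge> N]\<close> is the indicator of
    \<open>0 \<le> x < N\<close>, so the numerator enumerates the lattice points of the half-open
    parallelepiped spanned by the scaled generators. Neither it nor the denominator involves
    \<open>c\<close>.\<close>
  define p :: laurent where "p = Abs_poly_mapping (box_series n X J (\<lambda>_ x. of_bool (0 \<le> x \<and> x < N)))"
  have p: "Poly_Mapping.lookup p = box_series n X J (\<lambda>_ x. of_bool (0 \<le> x \<and> x < N))"
    unfolding p_def by (rule lookup_Abs_poly_mapping[OF finite_support_box_series])
  have "represents (Fract p (q C)) (box_series n X J (\<lambda>s x. of_bool (0 \<le> x) - c s))" for c
  proof -
    have "laurent_times (q C) (box_series n X J (\<lambda>s x. of_bool (0 \<le> x) - c s))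
        = box_series n X J (\<lambda>s x. if s \<in> C then of_bool (0 \<le> x) - c s - (of_bool (0 \<le> x - N) - c s)
            else of_bool (0 \<le> x) - c s)"
      by (rule step) (auto simp: C_def)
    also have "\<dots> = Poly_Mapping.lookup p"
      unfolding p box_series_def C_def[symmetric] using N
      by (intro ext if_cong refl prod.cong) auto
    finally show ?thesis using \<open>q C \<noteq> 0\<close> unfolding represents_def by blast
  qed
  then show thesis by (rule that)
qed

section \<open>The output cones\<close>

lemma pick_lessThan: "i < n \<Longrightarrow> pick {..<n} i = i"
proof -
  assume "i < n"
  then have "{a \<in> {..<n}. a < i} = {..<i}" by auto
  then show ?thesis using pick_card_in_set[of i "{..<n}"] \<open>i < n\<close> by simp
qed

text \<open>The set \<open>- J\<close> begins with the elements of \<open>{..<n} - J\<close>,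
  followed by \<open>n\<close>; the vertex therefore remains the last column of the output
  matrix.\<close>

lemma pick_compl:
  assumes "J \<subseteq> {..<n}"
  shows "bij_betw (pick (- J)) {..<card ({..<n} - J)} ({..<n} - J)"
    and "pick (- J) (card ({..<n} - J)) = n"
proof -
  have "finite J" using assms finite_lessThan by (rule finite_subset)
  then have inf: "infinite (- J)" using finite_compl by auto
  have "{a \<in> - J. a < n} = {..<n} - J" by auto
  then show last: "pick (- J) (card ({..<n} - J)) = n"
    using pick_card_in_set[of n "- J"] assms by auto
  have "inj_on (pick (- J)) {..<card ({..<n} - J)}"
    by (rule inj_onI) (use pick_eq_iff_inf[OF inf] in blast)
  moreover have "pick (- J) ` {..<card ({..<n} - J)} \<subseteq> {..<n} - J"
    using pick_mono_inf[OF inf, of _ "card ({..<n} - J)"] pick_in_set_inf[OF inf] unfolding last by auto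
  ultimately show "bij_betw (pick (- J)) {..<card ({..<n} - J)} ({..<n} - J)"
    by (simp add: bij_betw_def card_subset_eq card_image)
qed

lemma output_matrix_dims:
  assumes X: "X \<in> carrier_mat (n + r) (n + 1)" and J: "J \<subseteq> {..<n}"
  shows "dim_row (output_matrix n X J) = n" and "dim_col (output_matrix n X J) = card ({..<n} - J) + 1"
proof -
  have "{i. i < n + r \<and> i < n} = {..<n}" by auto
  then show "dim_row (output_matrix n X J) = n"
    using X by (simp add: output_matrix_def dim_submatrix)
  have "{j. j < n + 1 \<and> j \<in> - J} = insert n ({..<n} - J)" using J by auto
  then show "dim_col (output_matrix n X J) = card ({..<n} - J) + 1"
    using X by (simp add: output_matrix_def dim_submatrix)
qed

lemma output_matrix_index:
  assumes X: "X \<in> carrier_mat (n + r) (n + 1)" and J: "J \<subseteq> {..<n}"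
    and "k < n" "l \<le> card ({..<n} - J)"
  shows "output_matrix n X J $$ (k, l) = X $$ (k, pick (- J) l)"
  using output_matrix_dims[OF X J] assms(3,4)
  by (simp add: output_matrix_def dim_submatrix submatrix_index pick_lessThan)

text \<open>The identity block survives the deletion of rows and columns. Row
  \<open>pick (- J) l\<close> reads off the coefficient of generator \<open>l\<close>, which serves
  both independence and cone membership.\<close>

lemma output_matrix_unit:
  assumes X: "X \<in> carrier_mat (n + r) (n + 1)" and J: "J \<subseteq> {..<n}" and red: "reduced n X J"
    and l: "l < card ({..<n} - J)" "l' < card ({..<n} - J)"
  shows "pick (- J) l < n" and "output_matrix n X J $$ (pick (- J) l, l') = of_bool (l = l')"
    and "output_matrix n X J $$ (pick (- J) l, card ({..<n} - J)) = 0"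
proof -
  note bij = pick_compl[OF J]
  have in_C: "pick (- J) l \<in> {..<n} - J" "pick (- J) l' \<in> {..<n} - J"
    using bij_betwE[OF bij(1)] l by auto
  then show "pick (- J) l < n" by simp
  have "pick (- J) l = pick (- J) l' \<longleftrightarrow> l = l'"
    using bij_betw_imp_inj_on[OF bij(1)] l by (auto dest: inj_onD)
  then show "output_matrix n X J $$ (pick (- J) l, l') = of_bool (l = l')"
    using in_C red l by (simp add: output_matrix_index[OF X J] reduced_def)
  show "output_matrix n X J $$ (pick (- J) l, card ({..<n} - J)) = 0"
    using in_C red by (simp add: output_matrix_index[OF X J] reduced_def bij(2))
qed

text \<open>A vanishing combination, read in row \<open>pick (- J) l\<close>, isolates the
  coefficient of generator \<open>l\<close>.\<close>

lemma simplicial_output_matrix: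
  assumes X: "X \<in> carrier_mat (n + r) (n + 1)" and J: "J \<subseteq> {..<n}" and red: "reduced n X J"
  shows "simplicial (output_matrix n X J)"
proof -
  define W where "W = output_matrix n X J"
  define m where "m = card ({..<n} - J)"
  define v :: "nat \<Rightarrow> real vec" where "v l = map_vec of_rat (col W l)" for l
  note dims = output_matrix_dims[OF X J, folded W_def m_def]
  note unit = output_matrix_unit[OF X J red, folded W_def m_def]
  have gens: "generators W = map v [0..<m]" using dims by (simp add: generators_def v_def)
  have at: "v l' $ pick (- J) l = of_bool (l = l')" if "l < m" "l' < m" for l l'
    using unit[OF that] dims that by (simp add: v_def)
  have inj: "inj_on v {..<m}"
  proof (rule inj_onI)
    fix l l' assume l: "l \<in> {..<m}" "l' \<in> {..<m}" and "v l = v l'"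
    then show "l = l'" using at[of l l'] at[of l l] by (auto split: if_splits)
  qed
  interpret vec_space "TYPE(real)" n .
  have carrier: "v ` {..<m} \<subseteq> carrier_vec n" using dims by (auto simp: v_def)
  have "lin_indpt (v ` {..<m})"
  proof (rule finite_lin_indpt2)
    fix a :: "real vec \<Rightarrow> real"
    assume zero: "lincomb a (v ` {..<m}) = 0\<^sub>v n"
    show "\<forall>x\<in>v ` {..<m}. a x = 0"
    proof
      fix x assume "x \<in> v ` {..<m}"
      then obtain l where l: "l < m" "x = v l" by auto
      have "0 = lincomb a (v ` {..<m}) $ pick (- J) l" using zero unit(1)[OF l(1) l(1)] by simp
      also have "\<dots> = (\<Sum>l'<m. a (v l') * v l' $ pick (- J) l)"
        using lincomb_index[OF unit(1)[OF l(1) l(1)] carrier] inj by (simp add: sum.reindex)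
      also have "\<dots> = (\<Sum>l'<m. if l' = l then a (v l) else 0)"
        by (intro sum.cong) (auto simp: at l(1))
      also have "\<dots> = a x" using l by simp
      finally show "a x = 0" by simp
    qed
  qed (use carrier in auto)
  moreover have "set (generators W) = v ` {..<m}" by (simp add: gens lessThan_atLeast0)
  moreover have "distinct (generators W)"
    using inj by (simp add: gens distinct_map lessThan_atLeast0)
  ultimately show ?thesis
    using dims unfolding simplicial_def W_def[symmetric] by simp
qed

text \<open>The unit rows force each cone coefficient to be a coordinate of the point. The
  existential quantifier disappears and what remains is the flat condition with signs.\<close>

lemma integer_point_in_output_cone_iff:
  assumes X: "X \<in> carrier_mat (n + r) (n + 1)" and J: "J \<subseteq> {..<n}" and red: "reduced n X J"
  shows "vec n (\<lambda>i. real_of_int (y i)) \<in> shifted_cone (output_matrix n X J) \<longleftrightarrow>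
           on_flat n X J y \<and> (\<forall>s\<in>{..<n} - J. 0 \<le> y s)"
proof -
  define W where "W = output_matrix n X J"
  define m where "m = card ({..<n} - J)"
  note dims = output_matrix_dims[OF X J, folded W_def m_def]
  note unit = output_matrix_unit[OF X J red, folded W_def m_def]
  note index = output_matrix_index[OF X J, folded W_def m_def]
  note bij = pick_compl[OF J, folded m_def]
  have cone: "vec n (\<lambda>i. real_of_int (y i)) \<in> shifted_cone W \<longleftrightarrow>
      (\<exists>k. (\<forall>l<m. 0 \<le> k l) \<and> (\<forall>i<n. real_of_int (y i) = of_rat (W $$ (i, m)) + (\<Sum>l<m. k l * of_rat (W $$ (i, l)))))"
    unfolding shifted_cone_def Let_def using dims by (auto simp: vec_eq_iff)
  have k_eq: "k l = y (pick (- J) l)"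
    if eq: "\<forall>i<n. real_of_int (y i) = of_rat (W $$ (i, m)) + (\<Sum>l<m. k l * of_rat (W $$ (i, l)))"
      and l: "l < m" for k l
  proof -
    have "(\<Sum>l'<m. k l' * of_rat (W $$ (pick (- J) l, l'))) = (\<Sum>l'<m. if l' = l then k l else 0)"
      by (intro sum.cong) (auto simp: unit l)
    then show ?thesis using eq unit(1,3)[OF l l] l by simp
  qed
  have flat: "(\<forall>i<n. real_of_int (y i) = of_rat (W $$ (i, m))
      + (\<Sum>l<m. real_of_int (y (pick (- J) l)) * of_rat (W $$ (i, l)))) \<longleftrightarrow> on_flat n X J y"
  proof -
    have "of_rat (W $$ (i, m)) + (\<Sum>l<m. real_of_int (y (pick (- J) l)) * of_rat (W $$ (i, l)))
        = (of_rat (row_value n X J y i) :: real)" if "i < n" for i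
    proof -
      have "(\<Sum>s\<in>{..<n} - J. X $$ (i, s) * of_int (y s))
          = (\<Sum>l<m. X $$ (i, pick (- J) l) * of_int (y (pick (- J) l)))"
        by (rule sum.reindex_bij_betw[OF bij(1), symmetric])
      also have "\<dots> = (\<Sum>l<m. of_int (y (pick (- J) l)) * W $$ (i, l))"
        by (intro sum.cong) (auto simp: index that)
      finally show ?thesis
        unfolding row_value_def using that
        by (simp add: index bij(2) of_rat_add of_rat_sum of_rat_mult)
    qed
    moreover have "real_of_int (y i) = of_rat (row_value n X J y i) \<longleftrightarrow> of_int (y i) = row_value n X J y i" for i
      by (metis of_rat_eq_iff of_rat_of_int_eq)
    ultimately show ?thesis unfolding on_flat_def by simp
  qed
  have nonneg: "(\<forall>l<m. 0 \<le> real_of_int (y (pick (- J) l))) \<longleftrightarrow> (\<forall>s\<in>{..<n} - J. 0 \<le> y s)"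
    unfolding bij_betw_imp_surj_on[OF bij(1), symmetric] by auto
  show ?thesis
    unfolding W_def[symmetric] cone
  proof
    assume "\<exists>k. (\<forall>l<m. 0 \<le> k l) \<and> (\<forall>i<n. real_of_int (y i) = of_rat (W $$ (i, m)) + (\<Sum>l<m. k l * of_rat (W $$ (i, l))))"
    then obtain k where k: "\<forall>l<m. 0 \<le> k l"
        "\<forall>i<n. real_of_int (y i) = of_rat (W $$ (i, m)) + (\<Sum>l<m. k l * of_rat (W $$ (i, l)))" by blast
    have "(\<Sum>l<m. k l * of_rat (W $$ (i, l))) = (\<Sum>l<m. real_of_int (y (pick (- J) l)) * of_rat (W $$ (i, l)))" for i
      by (intro sum.cong refl) (simp only: k_eq[OF k(2)] lessThan_iff)
    moreover have "\<forall>l<m. 0 \<le> real_of_int (y (pick (- J) l))"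
      using k(1) by (metis k_eq[OF k(2)])
    ultimately show "on_flat n X J y \<and> (\<forall>s\<in>{..<n} - J. 0 \<le> y s)"
      using k(2) by (intro conjI flat[THEN iffD1] nonneg[THEN iffD1]) (simp_all only:)
  next
    assume "on_flat n X J y \<and> (\<forall>s\<in>{..<n} - J. 0 \<le> y s)"
    then show "\<exists>k. (\<forall>l<m. 0 \<le> k l) \<and> (\<forall>i<n. real_of_int (y i) = of_rat (W $$ (i, m)) + (\<Sum>l<m. k l * of_rat (W $$ (i, l))))"
      by (intro exI[of _ "\<lambda>l. real_of_int (y (pick (- J) l))"] conjI flat[THEN iffD2] nonneg[THEN iffD2]) (elim conjE, assumption)+
  qed
qed

text \<open>Subtracting 0 gives the form of \<open>represents_box_series\<close> with all constants
  zero.\<close>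

lemma lattice_series_output_cone:
  assumes X: "X \<in> carrier_mat (n + r) (n + 1)" and J: "J \<subseteq> {..<n}" and red: "reduced n X J"
  shows "lattice_series n (shifted_cone (output_matrix n X J)) = box_series n X J (\<lambda>s x. of_bool (0 \<le> x) - 0)"
proof
  fix e :: exponent
  have "(\<Prod>s\<in>{..<n} - J. of_bool (0 \<le> Poly_Mapping.lookup e s)) = (of_bool (\<forall>s\<in>{..<n} - J. 0 \<le> Poly_Mapping.lookup e s) :: rat)"
    by (auto intro: prod.neutral)
  then show "lattice_series n (shifted_cone (output_matrix n X J)) e = box_series n X J (\<lambda>s x. of_bool (0 \<le> x) - 0) e"
    unfolding lattice_series_def box_series_def integer_point_in_output_cone_iff[OF assms] by auto
qed

text \<open>Both series are instances of \<open>represents_box_series\<close> with the same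
  \<open>F\<close>: constants 0 for the cone, and 1 at the columns that are not lexicographically
  positive for the oriented series.\<close>

lemma represents_oriented_series:
  assumes X: "X \<in> carrier_mat (n + r) (n + 1)" and J: "J \<subseteq> {..<n}" and red: "reduced n X J"
  shows "represents (sigma n (shifted_cone (output_matrix n X J))) (box_series n X J (orient n X))"
    and "has_rational_gf n (shifted_cone (output_matrix n X J))"
proof -
  obtain F where F: "\<And>c. represents F (box_series n X J (\<lambda>s x. of_bool (0 \<le> x) - c s))"
    using represents_box_series[OF red] by blast
  from F[of "\<lambda>_. 0"] have "represents F (lattice_series n (shifted_cone (output_matrix n X J)))"
    unfolding lattice_series_output_cone[OF assms] .
  moreover from this have "sigma n (shifted_cone (output_matrix n X J)) = F" by (rule sigma_eqI)
  moreover have "orient n X = (\<lambda>s x. of_bool (0 \<le> x) - of_bool (\<not> lexpos n (\<lambda>k. X $$ (k, s))))"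
    by (auto simp: orient_def fun_eq_iff)
  ultimately show "represents (sigma n (shifted_cone (output_matrix n X J))) (box_series n X J (orient n X))"
    and "has_rational_gf n (shifted_cone (output_matrix n X J))"
    using F unfolding has_rational_gf_def by auto
qed

section \<open>The whole run\<close>

text \<open>Counting \<open>I\<close> ensures that after \<open>r\<close> steps no equation is left
  over.\<close>

definition valid_term :: "nat \<Rightarrow> nat \<Rightarrow> nat \<Rightarrow> cone_term \<Rightarrow> bool" where
  "valid_term n r t = (\<lambda>(s, X, I, J). X \<in> carrier_mat (n + r) (n + 1) \<and> reduced n X J \<and>
     J \<subseteq> {..<n} \<and> I \<subseteq> {..<r} \<and> card I = t)"

lemma initial_matrix_carrier:
  "A \<in> carrier_mat r n \<Longrightarrow> b \<in> carrier_vec r \<Longrightarrow> initial_matrix A b \<in> carrier_mat (n + r) (n + 1)"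
  by (auto simp: initial_matrix_def)

lemma initial_matrix_index:
  assumes "A \<in> carrier_mat r n" "b \<in> carrier_vec r"
  shows "k < n \<Longrightarrow> s < n \<Longrightarrow> initial_matrix A b $$ (k, s) = of_bool (k = s)"
    and "k < n \<Longrightarrow> initial_matrix A b $$ (k, n) = 0"
    and "l < r \<Longrightarrow> s < n \<Longrightarrow> initial_matrix A b $$ (n + l, s) = of_int (A $$ (l, s))"
    and "l < r \<Longrightarrow> initial_matrix A b $$ (n + l, n) = - of_int (b $ l)"
  using assms by (auto simp: initial_matrix_def mat_of_cols_def)

text \<open>The top block is the identity, so every point is on the flat and every column is
  lexicographically positive; the rows below state the equations of the polyhedron.\<close>

lemma initial_term_weight:
  assumes A: "A \<in> carrier_mat r n" and b: "b \<in> carrier_vec r"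
  shows "term_weight n r (1, initial_matrix A b, {}, {}) y
           = of_bool (vec n (\<lambda>i. real_of_int (y i)) \<in> polyhedron A b)"
proof -
  note index = initial_matrix_index[OF A b]
  let ?M = "initial_matrix A b"
  have row: "row_value n ?M {} y k = of_int (y k)" if "k < n" for k
  proof -
    have "(\<Sum>s<n. ?M $$ (k, s) * of_int (y s)) = (\<Sum>s<n. if s = k then of_int (y k) else 0)"
      by (intro sum.cong) (auto simp: index that)
    then show ?thesis using that by (simp add: row_value_def index)
  qed
  have "lexpos n (\<lambda>k. ?M $$ (k, s))" if "s < n" for s
    unfolding lexpos_def using that by (intro exI[of _ s]) (auto simp: index)
  then have prod: "(\<Prod>s<n. orient n ?M s (y s)) = of_bool (\<forall>s<n. 0 \<le> y s)"
    by (auto simp: orient_def intro: prod.neutral)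
  have eqn: "row_value n ?M {} y (n + l) = 0 \<longleftrightarrow>
      (map_mat real_of_int A *\<^sub>v vec n (\<lambda>i. real_of_int (y i))) $ l = map_vec real_of_int b $ l" if "l < r" for l
  proof -
    define z where "z = (\<Sum>s<n. A $$ (l, s) * y s)"
    have "row_value n ?M {} y (n + l) = of_int (z - b $ l)"
      using that by (simp add: row_value_def index z_def)
    moreover have "(map_mat real_of_int A *\<^sub>v vec n (\<lambda>i. real_of_int (y i))) $ l = of_int z"
      using that A by (simp add: scalar_prod_def z_def lessThan_atLeast0)
    ultimately show ?thesis using that b by (simp del: of_int_diff)
  qed
  have "vec n (\<lambda>i. real_of_int (y i)) \<in> polyhedron A b \<longleftrightarrow>
      (\<forall>s<n. 0 \<le> y s) \<and> (\<forall>l<r. row_value n ?M {} y (n + l) = 0)"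
    unfolding polyhedron_def using A b by (auto simp: vec_eq_iff eqn)
  then show ?thesis
    using row prod by (auto simp: term_weight_def on_flat_def)
qed

lemma eliminate_valid:
  assumes "valid_term n r t T" and "legal_choice n r T c" and "T' \<in> set (eliminate n T c)"
  shows "valid_term n r (Suc t) T'"
proof -
  obtain s X I J i \<phi> where T: "T = (s, X, I, J)" "c = (i, \<phi>)" by (metis prod_cases4 surj_pair)
  have finI: "finite I" using assms(1) T finite_subset by (auto simp: valid_term_def)
  obtain s' j where "T' = (s', pivot n X i j, insert i I, insert j J)" "j \<in> {..<n} - J"
    using assms(3) unfolding T by (cases \<phi>) auto
  then show ?thesis
    using assms(1,2) finI pivot_reduced[of X n r J j i] unfolding T by (auto simp: valid_term_def)
qed

lemma sum_list_map_concat: "(\<Sum>x\<leftarrow>concat xss. f x) = (\<Sum>xs\<leftarrow>xss. \<Sum>x\<leftarrow>xs. f x)"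
  by (induction xss) auto

lemma collection_invariant:
  assumes A: "A \<in> carrier_mat r n" and b: "b \<in> carrier_vec r" and S: "strategy_for S A b" and "t \<le> r"
  shows "(\<forall>T\<in>set (collection S A b t). valid_term n r t T) \<and>
         (\<forall>y. (\<Sum>T\<leftarrow>collection S A b t. term_weight n r T y) = term_weight n r (1, initial_matrix A b, {}, {}) y)"
  using \<open>t \<le> r\<close>
proof (induction t)
  case 0
  show ?case
    using initial_matrix_carrier[OF A b] initial_matrix_index[OF A b]
    by (simp add: valid_term_def reduced_def)
next
  case (Suc t)
  define L where "L = collection S A b t"
  have IH: "\<And>k. k < length L \<Longrightarrow> valid_term n r t (L ! k)"
      "\<And>y. (\<Sum>T\<leftarrow>L. term_weight n r T y) = term_weight n r (1, initial_matrix A b, {}, {}) y"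
    using Suc unfolding L_def by auto
  have legal: "legal_choice n r (L ! k) (S L k)" if "k < length L" for k
    using S A Suc.prems that unfolding strategy_for_def L_def Let_def by auto
  have next_L: "collection S A b (Suc t) = concat (map (\<lambda>k. eliminate n (L ! k) (S L k)) [0..<length L])"
    using A by (simp add: L_def Let_def)
  have "valid_term n r (Suc t) T" if "T \<in> set (collection S A b (Suc t))" for T
  proof -
    obtain k where "k < length L" "T \<in> set (eliminate n (L ! k) (S L k))"
      using \<open>T \<in> _\<close> unfolding next_L by auto
    then show ?thesis using eliminate_valid IH(1) legal by blast
  qed
  moreover have "(\<Sum>T\<leftarrow>collection S A b (Suc t). term_weight n r T y)
      = term_weight n r (1, initial_matrix A b, {}, {}) y" for y
  proof -
    have step: "(\<Sum>T\<leftarrow>eliminate n (L ! k) (S L k). term_weight n r T y) = term_weight n r (L ! k) y"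
      if k: "k < length L" for k
    proof -
      obtain s X I J i \<phi> where T: "L ! k = (s, X, I, J)" "S L k = (i, \<phi>)" by (metis prod_cases4 surj_pair)
      show ?thesis
        unfolding T by (rule term_weight_eliminate) (use IH(1)[OF k] legal[OF k] T in \<open>auto simp: valid_term_def\<close>)
    qed
    have "(\<Sum>T\<leftarrow>collection S A b (Suc t). term_weight n r T y)
        = (\<Sum>k\<leftarrow>[0..<length L]. \<Sum>T\<leftarrow>eliminate n (L ! k) (S L k). term_weight n r T y)"
      unfolding next_L by (simp add: sum_list_map_concat comp_def)
    also have "\<dots> = (\<Sum>k\<leftarrow>[0..<length L]. term_weight n r (L ! k) y)"
      by (intro arg_cong[of _ _ sum_list] map_cong refl) (simp add: step)
    also have "\<dots> = (\<Sum>T\<leftarrow>L. term_weight n r T y)"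
      by (subst (2) map_nth[of L, symmetric]) (simp add: comp_def del: map_nth)
    finally show ?thesis using IH(2) by simp
  qed
  ultimately show ?case by blast
qed

theorem mainTheorem1:
  fixes n r :: nat and A :: "int mat" and b :: "int vec" and S :: strategy
  assumes "A \<in> carrier_mat r n" and "b \<in> carrier_vec r"
    and "strategy_for S A b"
  shows "(\<forall>(s, X, J) \<in> set (SimpCone S A b).
            simplicial (output_matrix n X J) \<and>
            has_rational_gf n (shifted_cone (output_matrix n X J))) \<and>
         has_rational_gf n (polyhedron A b) \<and>
         sigma n (polyhedron A b) =
           (\<Sum>(s, X, J) \<leftarrow> SimpCone S A b.
              of_int s * sigma n (shifted_cone (output_matrix n X J)))"
proof -
  let ?L = "collection S A b r"
  define F where "F = (\<lambda>(s, X, J). of_int s * sigma n (shifted_cone (output_matrix n X J)))"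
  define f where "f = (\<lambda>(s, X, I :: nat set, J) e. of_int s * box_series n X J (orient n X) e)"
  note invariant = collection_invariant[OF assms order.refl]
  have run: "SimpCone S A b = map (\<lambda>(s, X, I, J). (s, X, J)) ?L"
    using assms(1) by (simp add: SimpCone_def)
  have valid: "X \<in> carrier_mat (n + r) (n + 1)" "J \<subseteq> {..<n}" "reduced n X J" "I = {..<r}"
    if "(s, X, I, J) \<in> set ?L" for s X I J
  proof -
    have "valid_term n r r (s, X, I, J)" using invariant that by blast
    then show "X \<in> carrier_mat (n + r) (n + 1)" "J \<subseteq> {..<n}" "reduced n X J" "I = {..<r}"
      using card_subset_eq[of "{..<r}" I] by (auto simp: valid_term_def)
  qed
  have "represents (\<Sum>T\<leftarrow>?L. F ((\<lambda>(s, X, I, J). (s, X, J)) T)) (\<lambda>e. \<Sum>T\<leftarrow>?L. f T e)"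
  proof (rule represents_sum_list)
    fix T assume T: "T \<in> set ?L"
    obtain s X I J where [simp]: "T = (s, X, I, J)" by (cases T)
    show "represents (F ((\<lambda>(s, X, I, J). (s, X, J)) T)) (f T)"
      using represents_of_int_times[OF represents_oriented_series(1)[OF valid(1-3)], of s X I J] T
      by (simp add: F_def f_def)
  qed
  moreover have "(\<Sum>T\<leftarrow>?L. f T e) = lattice_series n (polyhedron A b) e" for e
  proof -
    \<comment> \<open>With \<open>I = {..<r}\<close> the condition on remaining equations is
      vacuous, so the weight is the oriented series of the output cone.\<close>
    have "f T e = (if Poly_Mapping.keys e \<subseteq> {..<n} then term_weight n r T (Poly_Mapping.lookup e) else 0)"
      if "T \<in> set ?L" for T
      using valid that by (cases T) (simp add: f_def box_series_def term_weight_def)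
    then have "(\<Sum>T\<leftarrow>?L. f T e)
        = (\<Sum>T\<leftarrow>?L. if Poly_Mapping.keys e \<subseteq> {..<n} then term_weight n r T (Poly_Mapping.lookup e) else 0)"
      by (simp cong: map_cong)
    also have "\<dots> = (if Poly_Mapping.keys e \<subseteq> {..<n}
        then term_weight n r (1, initial_matrix A b, {}, {}) (Poly_Mapping.lookup e) else 0)"
      using invariant by simp
    finally show ?thesis
      by (simp add: initial_term_weight[OF assms(1,2)] lattice_series_def)
  qed
  ultimately have "represents (\<Sum>x\<leftarrow>SimpCone S A b. F x) (lattice_series n (polyhedron A b))"
    by (simp add: run comp_def)
  then have "has_rational_gf n (polyhedron A b)" "sigma n (polyhedron A b) = (\<Sum>x\<leftarrow>SimpCone S A b. F x)"
    unfolding has_rational_gf_def by (blast, rule sigma_eqI)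
  moreover have "simplicial (output_matrix n X J) \<and> has_rational_gf n (shifted_cone (output_matrix n X J))"
    if mem: "(s, X, J) \<in> set (SimpCone S A b)" for s X J
  proof -
    obtain I where "(s, X, I, J) \<in> set ?L" using mem unfolding run by auto
    note valid = valid(1-3)[OF this]
    show ?thesis using simplicial_output_matrix[OF valid] represents_oriented_series(2)[OF valid] by blast
  qed
  ultimately show ?thesis unfolding F_def by blast
qed

end
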